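(* Let $(A,\mathfrak{m})$ be a noetherian local ring with infinite residue field. Let $\mathfrak{a}$ be an ideal of $A$ such that $A/\mathfrak{a}$ has finite integral degree $\mathrm{d}_{A/\mathfrak{a}}(\overline{A/\mathfrak{a}})=d$. Let $I$ be a two-generated ideal of $A$ such that $I(A/\mathfrak{a})$ is $A/\mathfrak{a}$-regular. Then, for every integer $n\ge d$, $$I^{n}\cap\mathfrak{a}=I^{n-d}(I^{d}\cap\mathfrak{a})+\mathfrak{m}I^{n}\cap\mathfrak{a}.$$
   Context: All rings are commutative with identity. The last term means $(\mathfrak{m}I^{n})\cap\mathfrak{a}$. An ideal of a ring $R$ is $R$-regular if it is not contained in the set of zero divisors of $R$. Two-generated means generated by two elements. Integral degree: if $R\subseteq B$ is a ring extension and $b\in B$ is integral over $R$, then $\mathrm{id}_R(b)$ is the least $n\ge1$ such that $b$ satisfies a monic polynomial equation of degree $n$ with coefficients in $R$. If $R\subseteq B$ is an integral extension, $\mathrm{d}_R(B)=\sup\{\mathrm{id}_R(b)\mid b\in B\}$. $\overline{R}$ denotes the integral closure of $R$ in its total quotient ring, and $\mathrm{d}_R(\overline{R})$ is called the integral degree of $R$. *)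

theory Defs
  imports "HOL-Algebra.Algebra" "HOL-Library.Extended_Nat"
begin

definition local_ring :: "('a, 'b) ring_scheme \<Rightarrow> 'a set \<Rightarrow> bool" where
  "local_ring R M \<longleftrightarrow> cring R \<and> maximalideal M R \<and> (\<forall>J. maximalideal J R \<longrightarrow> J = M)"

definition two_generated :: "('a, 'b) ring_scheme \<Rightarrow> 'a set \<Rightarrow> bool" where
  "two_generated R I \<longleftrightarrow> (\<exists>x \<in> carrier R. \<exists>y \<in> carrier R. I = Idl\<^bsub>R\<^esub> {x, y})"

primrec ideal_pow :: "('a, 'b) ring_scheme \<Rightarrow> 'a set \<Rightarrow> nat \<Rightarrow> 'a set" where
  "ideal_pow R I 0 = carrier R"
| "ideal_pow R I (Suc n) = ideal_pow R I n \<cdot>\<^bsub>R\<^esub> I"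

text \<open>The extension \<open>I(R/J)\<close> of the ideal \<open>I\<close> along the projection \<open>R \<rightarrow> R/J\<close>.\<close>

definition quot_ext :: "('a, 'b) ring_scheme \<Rightarrow> 'a set \<Rightarrow> 'a set \<Rightarrow> 'a set set" where
  "quot_ext R J I = Idl\<^bsub>R Quot J\<^esub> ((\<lambda>x. J +>\<^bsub>R\<^esub> x) ` I)"

text \<open>Zero counts as a zero divisor, except in the zero ring.\<close>

definition zero_divisors :: "('a, 'b) ring_scheme \<Rightarrow> 'a set" where
  "zero_divisors R =
     {x \<in> carrier R. \<exists>y \<in> carrier R. y \<noteq> \<zero>\<^bsub>R\<^esub> \<and> x \<otimes>\<^bsub>R\<^esub> y = \<zero>\<^bsub>R\<^esub>}"

definition regular_ideal :: "('a, 'b) ring_scheme \<Rightarrow> 'a set \<Rightarrow> bool" where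
  "regular_ideal R I \<longleftrightarrow> ideal I R \<and> \<not> I \<subseteq> zero_divisors R"


section \<open>The total quotient ring\<close>

text \<open>
  Fractions are classes of pairs (numerator, denominator). Denominators are non-zero-divisors,
  so \<open>a/s = b/t\<close> may be defined by \<open>a t = b s\<close>, without a further factor.
\<close>

definition tq_pairs :: "('a, 'b) ring_scheme \<Rightarrow> ('a \<times> 'a) set" where
  "tq_pairs R = carrier R \<times> (carrier R - zero_divisors R)"

definition tq_rel :: "('a, 'b) ring_scheme \<Rightarrow> (('a \<times> 'a) \<times> ('a \<times> 'a)) set" where
  "tq_rel R = {((a, s), (b, t)). (a, s) \<in> tq_pairs R \<and> (b, t) \<in> tq_pairs R \<and>
                  a \<otimes>\<^bsub>R\<^esub> t = b \<otimes>\<^bsub>R\<^esub> s}"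

definition tq_frac :: "('a, 'b) ring_scheme \<Rightarrow> 'a \<Rightarrow> 'a \<Rightarrow> ('a \<times> 'a) set" where
  "tq_frac R a s = tq_rel R `` {(a, s)}"

text \<open>
  The unions below range over representatives of the two classes and, for a commutative ring,
  are unions of equal sets.
\<close>

definition total_quotient_ring :: "('a, 'b) ring_scheme \<Rightarrow> ('a \<times> 'a) set ring" where
  "total_quotient_ring R =
     \<lparr> carrier = tq_pairs R // tq_rel R,
       monoid.mult = (\<lambda>U V. \<Union>p\<in>U. \<Union>q\<in>V.
                tq_frac R (fst p \<otimes>\<^bsub>R\<^esub> fst q) (snd p \<otimes>\<^bsub>R\<^esub> snd q)),
       monoid.one = tq_frac R \<one>\<^bsub>R\<^esub> \<one>\<^bsub>R\<^esub>,
       ring.zero = tq_frac R \<zero>\<^bsub>R\<^esub> \<one>\<^bsub>R\<^esub>,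
       ring.add = (\<lambda>U V. \<Union>p\<in>U. \<Union>q\<in>V.
                tq_frac R (fst p \<otimes>\<^bsub>R\<^esub> snd q \<oplus>\<^bsub>R\<^esub> fst q \<otimes>\<^bsub>R\<^esub> snd p)
                  (snd p \<otimes>\<^bsub>R\<^esub> snd q)) \<rparr>"

text \<open>The copy of \<open>R\<close> inside its total quotient ring.\<close>

definition tq_base :: "('a, 'b) ring_scheme \<Rightarrow> ('a \<times> 'a) set set" where
  "tq_base R = (\<lambda>a. tq_frac R a \<one>\<^bsub>R\<^esub>) ` carrier R"


section \<open>Integral elements and the integral degree\<close>

text \<open>
  Below, \<open>S\<close> is an ambient ring and \<open>K \<subseteq> B\<close> are (carriers of) subrings of it.
  A monic equation of degree \<open>n\<close> is given by the coefficients below the leading one; this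
  makes sense in the zero ring as well.
\<close>

definition monic_root :: "('a, 'b) ring_scheme \<Rightarrow> 'a set \<Rightarrow> nat \<Rightarrow> 'a \<Rightarrow> bool" where
  "monic_root S K n b \<longleftrightarrow>
     (\<exists>c. (\<forall>i<n. c i \<in> K) \<and>
          b [^]\<^bsub>S\<^esub> n \<oplus>\<^bsub>S\<^esub> (\<Oplus>\<^bsub>S\<^esub>i\<in>{..<n}. c i \<otimes>\<^bsub>S\<^esub> b [^]\<^bsub>S\<^esub> i) = \<zero>\<^bsub>S\<^esub>)"

definition integral_over :: "('a, 'b) ring_scheme \<Rightarrow> 'a set \<Rightarrow> 'a \<Rightarrow> bool" where
  "integral_over S K b \<longleftrightarrow> b \<in> carrier S \<and> (\<exists>n\<ge>1. monic_root S K n b)"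

definition elem_integral_degree :: "('a, 'b) ring_scheme \<Rightarrow> 'a set \<Rightarrow> 'a \<Rightarrow> nat" where
  "elem_integral_degree S K b = (LEAST n. n \<ge> 1 \<and> monic_root S K n b)"

definition ext_integral_degree :: "('a, 'b) ring_scheme \<Rightarrow> 'a set \<Rightarrow> 'a set \<Rightarrow> enat" where
  "ext_integral_degree S K B = (SUP b\<in>B. enat (elem_integral_degree S K b))"

definition integral_closure :: "('a, 'b) ring_scheme \<Rightarrow> ('a \<times> 'a) set set" where
  "integral_closure R = {b. integral_over (total_quotient_ring R) (tq_base R) b}"

definition integral_degree :: "('a, 'b) ring_scheme \<Rightarrow> enat" where
  "integral_degree R =
     ext_integral_degree (total_quotient_ring R) (tq_base R) (integral_closure R)"

end

theory Submission
  imports Defs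
begin

text \<open>
  Let \<open>I = (x, y)\<close> and let \<open>f \<in> I\<^sup>n \<inter> \<aa>\<close> with \<open>n > d\<close>, so that \<open>f\<close> is the value of a form of degree
  \<open>n\<close> in \<open>x, y\<close>. If \<open>f \<notin> \<mm>I\<^sup>n\<close> then, the residue field being infinite, for almost all \<open>\<lambda>\<close> the form
  is, up to a unit, monic in \<open>y\<close> after the substitution \<open>u = x + \<lambda>y\<close>, and some of
  these \<open>u\<close> are regular modulo \<open>\<aa>\<close>. As \<open>f\<close> vanishes modulo \<open>\<aa>\<close>, the fraction \<open>y/u\<close> is integral
  over \<open>A/\<aa>\<close>, hence a root of a monic polynomial of degree \<open>d\<close>. Its homogenisation is an element
  \<open>H = y\<^sup>d + uh\<close> of \<open>I\<^sup>d \<inter> \<aa>\<close>. Subtracting a multiple of \<open>H\<close> from \<open>f\<close> leaves \<open>ug\<close>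
  with \<open>g \<in> I\<^bsup>n-1\<^esup>\<close>, and \<open>g \<in> \<aa>\<close> since \<open>u\<close> is regular modulo \<open>\<aa>\<close>; conclude by
  induction on \<open>n\<close>.
\<close>

section \<open>Quotients by an ideal, local rings\<close>

lemma (in ideal) rcos_eq_zero_iff:
  "z \<in> carrier R \<Longrightarrow> I +> z = \<zero>\<^bsub>R Quot I\<^esub> \<longleftrightarrow> z \<in> I"
  using rcos_const_imp_mem[of z] a_rcos_zero[OF is_ideal, of z] by (auto simp: FactRing_def)

lemma (in ideal) carrier_Quot: "carrier (R Quot I) = (+>) I ` carrier R"
  by (auto simp: FactRing_def A_RCOSETS_def')

text \<open>Regularity modulo \<open>I\<close> becomes a cancellation property in the ring itself,
  so that later arguments about regular elements need no cosets.\<close>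

lemma (in ideal) rcos_not_zero_divisor_iff:
  assumes "z \<in> carrier R"
  shows "I +> z \<notin> zero_divisors (R Quot I) \<longleftrightarrow> (\<forall>g\<in>carrier R. z \<otimes> g \<in> I \<longrightarrow> g \<in> I)"
proof -
  have "(I +> z) \<otimes>\<^bsub>R Quot I\<^esub> (I +> g) = \<zero>\<^bsub>R Quot I\<^esub> \<longleftrightarrow> z \<otimes> g \<in> I" if "g \<in> carrier R" for g
    using ring_hom_mult[OF rcos_ring_hom assms that] rcos_eq_zero_iff[of "z \<otimes> g"] assms that by simp
  then show ?thesis
    using assms rcos_eq_zero_iff by (auto simp: zero_divisors_def carrier_Quot)
qed

text \<open>One representative is chosen from each residue class. For the maximal ideal of a local
  ring the differences obtained are units.\<close>

lemma (in ideal) infinite_representatives: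
  assumes "infinite (carrier (R Quot I))"
  obtains L where "infinite L" "L \<subseteq> carrier R" "\<And>k l. k \<in> L \<Longrightarrow> l \<in> L \<Longrightarrow> k \<noteq> l \<Longrightarrow> k \<ominus> l \<notin> I"
proof -
  define r where "r C = (SOME z. z \<in> carrier R \<and> I +> z = C)" for C
  have r: "r C \<in> carrier R \<and> I +> r C = C" if "C \<in> carrier (R Quot I)" for C
    unfolding r_def by (rule someI_ex) (use that in \<open>auto simp: carrier_Quot\<close>)
  have "inj_on r (carrier (R Quot I))" using r by (metis inj_onI)
  then have "infinite (r ` carrier (R Quot I))" using assms finite_imageD by blast
  moreover have "k = l" if "k \<in> r ` carrier (R Quot I)" "l \<in> r ` carrier (R Quot I)" "k \<ominus> l \<in> I" for k l
    using that r quotient_eq_iff_same_a_r_cos[OF is_ideal, of k l] by auto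
  ultimately show ?thesis using r by (intro that) auto
qed

text \<open>Otherwise \<open>PIdl c\<close> is proper and Zorn's lemma enlarges it to a maximal
  ideal, which must be \<open>M\<close> and yet contains \<open>c\<close>.\<close>

lemma (in cring) not_in_local_maximal_imp_unit:
  assumes loc: "local_ring R M" and c: "c \<in> carrier R" "c \<notin> M"
  shows "c \<in> Units R"
proof (rule ccontr)
  assume nu: "c \<notin> Units R"
  \<comment> \<open>Properness is expressed by \<open>\<one> \<notin> J\<close>, a condition that
    passes to unions of chains.\<close>
  define F where "F = {J. ideal J R \<and> c \<in> J \<and> \<one> \<notin> J}"
  have "\<one> \<notin> PIdl c"
  proof
    assume "\<one> \<in> PIdl c"
    then obtain z where "z \<in> carrier R" "z \<otimes> c = \<one>" unfolding cgenideal_def by auto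
    then have "c \<in> Units R" using c m_comm[of c] unfolding Units_def by fastforce
    with nu show False ..
  qed
  then have F0: "PIdl c \<in> F"
    using c cgenideal_ideal cgenideal_self unfolding F_def by simp
  have "\<exists>N\<in>F. \<forall>Z\<in>F. N \<subseteq> Z \<longrightarrow> Z = N"
  proof (rule subset_Zorn_nonempty)
    show "F \<noteq> {}" using F0 by auto
    fix C assume C: "C \<noteq> {}" "subset.chain F C"
    then have CF: "C \<subseteq> F" unfolding pred_on.chain_def by simp
    have "subset.chain {J. ideal J R} C"
      using C unfolding pred_on.chain_def F_def by auto
    then have "ideal (\<Union>C) R" using chain_Union_is_ideal[of C] C by simp
    then show "\<Union>C \<in> F" using C(1) CF unfolding F_def by auto
  qed
  then obtain N where N: "N \<in> F" "\<And>Z. Z \<in> F \<Longrightarrow> N \<subseteq> Z \<Longrightarrow> Z = N" by blast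
  have "maximalideal N R"
  proof (rule maximalidealI)
    show "ideal N R" using N(1) unfolding F_def by simp
    show "carrier R \<noteq> N" using N(1) one_closed unfolding F_def by blast
    fix J assume J: "ideal J R" "N \<subseteq> J" "J \<subseteq> carrier R"
    show "J = N \<or> J = carrier R"
    proof (cases "\<one> \<in> J")
      case True then show ?thesis using ideal.one_imp_carrier[OF J(1)] by simp
    next
      case False
      then have "J \<in> F" using J N(1) unfolding F_def by auto
      then show ?thesis using N(2) J(2) by simp
    qed
  qed
  then have "N = M" using loc unfolding local_ring_def by blast
  then show False using N(1) c(2) unfolding F_def by simp
qed


section \<open>The total quotient ring\<close>

context cring
begin

abbreviation nzd :: "'a set" where "nzd \<equiv> carrier R - zero_divisors R"

abbreviation (input) TQ where "TQ \<equiv> total_quotient_ring R"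

lemma nzd_carrier: "s \<in> nzd \<Longrightarrow> s \<in> carrier R"
  by simp

lemma nzd_eq_zeroD: "s \<in> nzd \<Longrightarrow> y \<in> carrier R \<Longrightarrow> s \<otimes> y = \<zero> \<Longrightarrow> y = \<zero>"
  by (auto simp: zero_divisors_def)

lemma nzdI: "s \<in> carrier R \<Longrightarrow> (\<And>y. y \<in> carrier R \<Longrightarrow> s \<otimes> y = \<zero> \<Longrightarrow> y = \<zero>) \<Longrightarrow> s \<in> nzd"
  by (auto simp: zero_divisors_def)

lemma one_nzd: "\<one> \<in> nzd"
  by (rule nzdI) auto

lemma nzd_mult: "s \<in> nzd \<Longrightarrow> t \<in> nzd \<Longrightarrow> s \<otimes> t \<in> nzd"
  by (rule nzdI) (auto simp: m_assoc intro: nzd_eq_zeroD)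

lemma nzd_cancel:
  assumes s: "s \<in> nzd" and a: "a \<in> carrier R" and b: "b \<in> carrier R" and e: "a \<otimes> s = b \<otimes> s"
  shows "a = b"
proof -
  have sc: "s \<in> carrier R" using s by simp
  have "s \<otimes> (a \<ominus> b) = a \<otimes> s \<ominus> b \<otimes> s"
    using sc a b by algebra
  also have "\<dots> = \<zero>"
    using e sc a b by (simp add: r_neg minus_eq)
  finally have "a \<ominus> b = \<zero>"
    using nzd_eq_zeroD[OF s] a b by simp
  then show ?thesis using a b by simp
qed

lemma tq_rel_iff:
  "((a, s), (b, t)) \<in> tq_rel R \<longleftrightarrow>
    a \<in> carrier R \<and> s \<in> nzd \<and> b \<in> carrier R \<and> t \<in> nzd \<and> a \<otimes> t = b \<otimes> s"
  by (auto simp: tq_rel_def tq_pairs_def)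

lemma equiv_tq_rel: "equiv (tq_pairs R) (tq_rel R)"
proof (rule equivI)
  show "tq_rel R \<subseteq> tq_pairs R \<times> tq_pairs R" by (auto simp: tq_rel_def)
  show "refl_on (tq_pairs R) (tq_rel R)"
    by (auto simp: refl_on_def tq_rel_def tq_pairs_def)
  show "sym (tq_rel R)"
    by (auto simp: sym_def tq_rel_def tq_pairs_def)
  show "trans (tq_rel R)"
  proof (rule transI, clarify)
    fix a s b t c u
    assume "((a, s), (b, t)) \<in> tq_rel R" and "((b, t), (c, u)) \<in> tq_rel R"
    then have c: "a \<in> carrier R" "s \<in> nzd" "b \<in> carrier R" "t \<in> nzd" "c \<in> carrier R" "u \<in> nzd"
      and e: "a \<otimes> t = b \<otimes> s" "b \<otimes> u = c \<otimes> t"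
      by (auto simp: tq_rel_iff)
    note cc = c(1,3,5) c(2,4,6)[THEN nzd_carrier]
    \<comment> \<open>The middle denominator \<open>t\<close> is multiplied in and cancelled again,
      which is possible because it is not a zero divisor.\<close>
    have "(a \<otimes> u) \<otimes> t = (a \<otimes> t) \<otimes> u" using cc by (simp add: m_ac)
    also have "\<dots> = (b \<otimes> u) \<otimes> s" unfolding e(1) using cc by (simp add: m_ac)
    also have "\<dots> = (c \<otimes> s) \<otimes> t" unfolding e(2) using cc by (simp add: m_ac)
    finally have "a \<otimes> u = c \<otimes> s" using nzd_cancel[OF c(4)] cc by simp
    with c show "((a, s), (c, u)) \<in> tq_rel R" by (simp add: tq_rel_iff)
  qed
qed

lemma tq_frac_eq_iff:
  assumes "a \<in> carrier R" "s \<in> nzd" "b \<in> carrier R" "t \<in> nzd"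
  shows "tq_frac R a s = tq_frac R b t \<longleftrightarrow> a \<otimes> t = b \<otimes> s"
  using eq_equiv_class_iff[OF equiv_tq_rel, of "(a, s)" "(b, t)"] assms
  by (simp add: tq_frac_def tq_pairs_def tq_rel_iff)

lemma tq_frac_closed: "a \<in> carrier R \<Longrightarrow> s \<in> nzd \<Longrightarrow> tq_frac R a s \<in> carrier TQ"
  by (auto simp: total_quotient_ring_def tq_frac_def tq_pairs_def intro!: quotientI)

lemma tq_fracE:
  assumes "U \<in> carrier TQ"
  obtains a s where "a \<in> carrier R" "s \<in> nzd" "U = tq_frac R a s"
  using assms by (auto simp: total_quotient_ring_def tq_frac_def tq_pairs_def elim!: quotientE)

text \<open>The union over representatives collapses, since changing the representative of one
  factor does not change the resulting fraction; commutativity transfers this to the other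
  factor.\<close>

lemma tq_mult:
  assumes "a \<in> carrier R" "s \<in> nzd" "b \<in> carrier R" "t \<in> nzd"
  shows "tq_frac R a s \<otimes>\<^bsub>TQ\<^esub> tq_frac R b t = tq_frac R (a \<otimes> b) (s \<otimes> t)"
proof -
  have "congruent2 (tq_rel R) (tq_rel R)
      (\<lambda>p q. tq_frac R (fst p \<otimes> fst q) (snd p \<otimes> snd q))"
  proof (rule congruent2I[OF equiv_tq_rel equiv_tq_rel]; clarsimp simp: tq_pairs_def tq_rel_iff)
    fix a s b t c u
    assume c: "a \<in> carrier R" "s \<in> carrier R" "b \<in> carrier R" "t \<in> carrier R" "c \<in> carrier R" "u \<in> carrier R"
      and n: "s \<notin> zero_divisors R" "t \<notin> zero_divisors R" "u \<notin> zero_divisors R"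
      and e: "a \<otimes> t = b \<otimes> s"
    have "(a \<otimes> c) \<otimes> (t \<otimes> u) = (a \<otimes> t) \<otimes> (c \<otimes> u)" using c by (simp add: m_ac)
    also have "\<dots> = (b \<otimes> c) \<otimes> (s \<otimes> u)" unfolding e using c by (simp add: m_ac)
    finally have 1: "(a \<otimes> c) \<otimes> (t \<otimes> u) = (b \<otimes> c) \<otimes> (s \<otimes> u)" .
    then show "tq_frac R (a \<otimes> c) (s \<otimes> u) = tq_frac R (b \<otimes> c) (t \<otimes> u)"
      using c n nzd_mult by (subst tq_frac_eq_iff) auto
    then show "tq_frac R (c \<otimes> a) (u \<otimes> s) = tq_frac R (c \<otimes> b) (u \<otimes> t)"
      using c by (simp add: m_comm)
  qed
  from UN_equiv_class2[OF equiv_tq_rel equiv_tq_rel this, of "(a, s)" "(b, t)"] assms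
  show ?thesis by (simp add: total_quotient_ring_def tq_frac_def tq_pairs_def)
qed

lemma tq_add:
  assumes "a \<in> carrier R" "s \<in> nzd" "b \<in> carrier R" "t \<in> nzd"
  shows "tq_frac R a s \<oplus>\<^bsub>TQ\<^esub> tq_frac R b t = tq_frac R (a \<otimes> t \<oplus> b \<otimes> s) (s \<otimes> t)"
proof -
  have "congruent2 (tq_rel R) (tq_rel R)
      (\<lambda>p q. tq_frac R (fst p \<otimes> snd q \<oplus> fst q \<otimes> snd p) (snd p \<otimes> snd q))"
  proof (rule congruent2I[OF equiv_tq_rel equiv_tq_rel]; clarsimp simp: tq_pairs_def tq_rel_iff)
    fix a s b t c u
    assume c: "a \<in> carrier R" "s \<in> carrier R" "b \<in> carrier R" "t \<in> carrier R" "c \<in> carrier R" "u \<in> carrier R"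
      and n: "s \<notin> zero_divisors R" "t \<notin> zero_divisors R" "u \<notin> zero_divisors R"
      and e: "a \<otimes> t = b \<otimes> s"
    have "(a \<otimes> u \<oplus> c \<otimes> s) \<otimes> (t \<otimes> u) = (a \<otimes> t) \<otimes> (u \<otimes> u) \<oplus> (c \<otimes> s) \<otimes> (t \<otimes> u)"
      using c by (simp add: l_distr r_distr m_ac)
    also have "\<dots> = (b \<otimes> u \<oplus> c \<otimes> t) \<otimes> (s \<otimes> u)"
      unfolding e using c by (simp add: l_distr r_distr m_ac)
    finally have 1: "(a \<otimes> u \<oplus> c \<otimes> s) \<otimes> (t \<otimes> u) = (b \<otimes> u \<oplus> c \<otimes> t) \<otimes> (s \<otimes> u)" .
    then show "tq_frac R (a \<otimes> u \<oplus> c \<otimes> s) (s \<otimes> u) = tq_frac R (b \<otimes> u \<oplus> c \<otimes> t) (t \<otimes> u)"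
      using c n nzd_mult by (subst tq_frac_eq_iff) auto
    then show "tq_frac R (c \<otimes> s \<oplus> a \<otimes> u) (u \<otimes> s) = tq_frac R (c \<otimes> t \<oplus> b \<otimes> u) (u \<otimes> t)"
      using c by (simp add: m_comm a_comm)
  qed
  from UN_equiv_class2[OF equiv_tq_rel equiv_tq_rel this, of "(a, s)" "(b, t)"] assms
  show ?thesis by (simp add: total_quotient_ring_def tq_frac_def tq_pairs_def)
qed

lemma tq_one: "\<one>\<^bsub>TQ\<^esub> = tq_frac R \<one> \<one>" and tq_zero: "\<zero>\<^bsub>TQ\<^esub> = tq_frac R \<zero> \<one>"
  by (simp_all add: total_quotient_ring_def)

lemma total_quotient_ring_cring: "cring TQ"
proof (intro cringI abelian_groupI comm_monoidI)
  note [simp] = tq_mult tq_add tq_one tq_zero tq_frac_eq_iff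
  note nz [simp] = one_nzd[simplified] nzd_mult[simplified]
  show "\<one>\<^bsub>TQ\<^esub> \<in> carrier TQ" "\<zero>\<^bsub>TQ\<^esub> \<in> carrier TQ"
    by (simp_all only: tq_one tq_zero tq_frac_closed one_nzd one_closed zero_closed)
  fix U V W
  assume U: "U \<in> carrier TQ"
  then obtain a s where a: "a \<in> carrier R" "s \<in> carrier R" "s \<notin> zero_divisors R" "U = tq_frac R a s"
    by (elim tq_fracE) auto
  show "\<one>\<^bsub>TQ\<^esub> \<otimes>\<^bsub>TQ\<^esub> U = U" "\<zero>\<^bsub>TQ\<^esub> \<oplus>\<^bsub>TQ\<^esub> U = U"
    using a by simp_all
  have "tq_frac R (\<ominus> a) s \<oplus>\<^bsub>TQ\<^esub> U = \<zero>\<^bsub>TQ\<^esub>"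
    using a by (simp add: l_minus l_neg)
  then show "\<exists>V\<in>carrier TQ. V \<oplus>\<^bsub>TQ\<^esub> U = \<zero>\<^bsub>TQ\<^esub>"
    using a tq_frac_closed[of "\<ominus> a" s] by blast
  assume V: "V \<in> carrier TQ"
  then obtain b t where b: "b \<in> carrier R" "t \<in> carrier R" "t \<notin> zero_divisors R" "V = tq_frac R b t"
    by (elim tq_fracE) auto
  show "U \<otimes>\<^bsub>TQ\<^esub> V \<in> carrier TQ" "U \<oplus>\<^bsub>TQ\<^esub> V \<in> carrier TQ"
    using a b by (auto intro!: tq_frac_closed)
  show "U \<otimes>\<^bsub>TQ\<^esub> V = V \<otimes>\<^bsub>TQ\<^esub> U" "U \<oplus>\<^bsub>TQ\<^esub> V = V \<oplus>\<^bsub>TQ\<^esub> U"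
    using a b by (simp_all add: m_comm a_comm)
  assume W: "W \<in> carrier TQ"
  then obtain c u where c: "c \<in> carrier R" "u \<in> carrier R" "u \<notin> zero_divisors R" "W = tq_frac R c u"
    by (elim tq_fracE) auto
  show "U \<otimes>\<^bsub>TQ\<^esub> V \<otimes>\<^bsub>TQ\<^esub> W = U \<otimes>\<^bsub>TQ\<^esub> (V \<otimes>\<^bsub>TQ\<^esub> W)"
    using a b c by (simp add: m_ac)
  show "U \<oplus>\<^bsub>TQ\<^esub> V \<oplus>\<^bsub>TQ\<^esub> W = U \<oplus>\<^bsub>TQ\<^esub> (V \<oplus>\<^bsub>TQ\<^esub> W)"
    using a b c by (simp add: m_ac l_distr r_distr a_ac)
  show "(U \<oplus>\<^bsub>TQ\<^esub> V) \<otimes>\<^bsub>TQ\<^esub> W = U \<otimes>\<^bsub>TQ\<^esub> W \<oplus>\<^bsub>TQ\<^esub> V \<otimes>\<^bsub>TQ\<^esub> W"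
    using a b c by (simp add: m_ac l_distr r_distr a_ac)
qed

lemma tq_embedding_hom: "(\<lambda>a. tq_frac R a \<one>) \<in> ring_hom R TQ"
  by (rule ring_hom_memI)
     (auto simp: tq_one tq_mult tq_add one_nzd[simplified] intro: tq_frac_closed)

lemma tq_embedding_eq_zero_iff:
  "a \<in> carrier R \<Longrightarrow> tq_frac R a \<one> = \<zero>\<^bsub>TQ\<^esub> \<longleftrightarrow> a = \<zero>"
  by (simp add: tq_zero tq_frac_eq_iff one_nzd[simplified])

text \<open>The inverse is the fraction with numerator \<open>\<one>\<close>. This makes
  \<open>y/u\<close> available once \<open>u\<close> is regular modulo the ideal.\<close>

lemma tq_embedding_unit:
  assumes "s \<in> nzd"
  shows "tq_frac R s \<one> \<in> Units TQ"
proof -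
  interpret T: cring TQ by (rule total_quotient_ring_cring)
  have "tq_frac R \<one> s \<otimes>\<^bsub>TQ\<^esub> tq_frac R s \<one> = \<one>\<^bsub>TQ\<^esub>"
    using assms by (simp add: tq_one tq_mult tq_frac_eq_iff one_nzd[simplified])
  moreover have "tq_frac R \<one> s \<in> carrier TQ" "tq_frac R s \<one> \<in> carrier TQ"
    using assms one_nzd by (auto intro: tq_frac_closed)
  ultimately show ?thesis
    unfolding Units_def using T.m_comm by (intro CollectI conjI bexI) auto
qed

end


section \<open>Powers of a two-generated ideal\<close>

lemma (in cring) ideal_ideal_pow: "ideal I R \<Longrightarrow> ideal (ideal_pow R I n) R"
  by (induction n) (auto intro: oneideal ideal_prod_is_ideal)

lemma (in cring) ideal_pow_mult_Suc:
  "a \<in> I \<Longrightarrow> g \<in> ideal_pow R I n \<Longrightarrow> ideal I R \<Longrightarrow> a \<otimes> g \<in> ideal_pow R I (Suc n)"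
  using ideal_prod.prod[of g "ideal_pow R I n" a I R] ideal.Icarr[of I R a]
    ideal.Icarr[OF ideal_ideal_pow, of I g n] by (simp add: m_comm)

lemma (in cring) nat_pow_in_ideal_pow:
  assumes "ideal I R" "y \<in> I" shows "y [^] (n::nat) \<in> ideal_pow R I n"
  by (induction n) (use assms in \<open>auto intro: ideal_prod.prod\<close>)

lemma (in cring) pow_mult_in_ideal_pow:
  assumes I: "ideal I R" "y \<in> I" and g: "g \<in> ideal_pow R I n"
  shows "y [^] (k::nat) \<otimes> g \<in> ideal_pow R I (n + k)"
proof (induction k)
  case 0
  then show ?case using g ideal.Icarr[OF ideal_ideal_pow[OF I(1)] g] by simp
next
  case (Suc k)
  have "y [^] Suc k \<otimes> g = y \<otimes> (y [^] k \<otimes> g)"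
    using ideal.Icarr[OF I] ideal.Icarr[OF ideal_ideal_pow[OF I(1)] g] by (simp add: m_ac)
  then show ?case using ideal_pow_mult_Suc[OF I(2) Suc I(1)] by simp
qed

lemma (in cring) Idl_pair:
  assumes "x \<in> carrier R" "y \<in> carrier R"
  shows "Idl {x, y} = {a \<otimes> x \<oplus> b \<otimes> y | a b. a \<in> carrier R \<and> b \<in> carrier R}"
proof -
  let ?K = "PIdl x <+>\<^bsub>R\<^esub> PIdl y"
  have K: "?K = {a \<otimes> x \<oplus> b \<otimes> y | a b. a \<in> carrier R \<and> b \<in> carrier R}"
    by (auto simp: set_add_def' cgenideal_def)
  have "x = \<one> \<otimes> x \<oplus> \<zero> \<otimes> y" "y = \<zero> \<otimes> x \<oplus> \<one> \<otimes> y" using assms by simp_all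
  then have "{x, y} \<subseteq> ?K" unfolding K by blast
  moreover have "ideal ?K R" by (intro add_ideals cgenideal_ideal assms)
  ultimately have "Idl {x, y} \<subseteq> ?K" by (intro genideal_minimal)
  moreover have "?K \<subseteq> Idl {x, y}"
  proof -
    interpret J: ideal "Idl {x, y}" R by (rule genideal_ideal) (use assms in auto)
    have "x \<in> Idl {x, y}" "y \<in> Idl {x, y}" using genideal_self[of "{x, y}"] assms by auto
    then show ?thesis unfolding K by (auto intro: J.I_l_closed)
  qed
  ultimately show ?thesis using K by simp
qed

text \<open>Among the monomials of degree \<open>Suc n\<close> in \<open>u\<close> and
  \<open>y\<close>, all but the pure power of \<open>y\<close> are divisible by \<open>u\<close>.
  This decomposition replaces the use of forms in two variables.\<close>

lemma (in cring) mem_ideal_pow_SucE: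
  assumes u: "u \<in> carrier R" and y: "y \<in> carrier R" and I: "I = Idl {u, y}"
    and f: "f \<in> ideal_pow R I (Suc n)"
  obtains c h where "c \<in> carrier R" "h \<in> ideal_pow R I n" "f = c \<otimes> y [^] Suc n \<oplus> u \<otimes> h"
proof -
  have I': "ideal I R" unfolding I by (rule genideal_ideal) (use u y in auto)
  have yI: "y \<in> I" using genideal_self[of "{u,y}"] u y by (auto simp: I)
  have "\<exists>c\<in>carrier R. \<exists>h\<in>ideal_pow R I n. f = c \<otimes> y [^] Suc n \<oplus> u \<otimes> h"
    using f
  proof (induction n arbitrary: f)
    case 0
    then have "f \<in> Idl {u, y}" using I' ideal_prod_one[OF I'] ideal_prod_commute[OF I' oneideal] by (simp add: I)
    then obtain a b where "a \<in> carrier R" "b \<in> carrier R" "f = a \<otimes> u \<oplus> b \<otimes> y"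
      using u y by (auto simp: Idl_pair)
    then have "f = b \<otimes> y [^] Suc 0 \<oplus> u \<otimes> a" using u y by (simp add: m_comm a_comm)
    then show ?case using \<open>a \<in> carrier R\<close> \<open>b \<in> carrier R\<close> by auto
  next
    case (Suc n)
    let ?P = "ideal_pow R I (Suc n)"
    interpret P: ideal ?P R by (rule ideal_ideal_pow[OF I'])
    have "f \<in> ?P \<cdot> I" using Suc.prems by simp
    then show ?case
    proof (induction rule: ideal_prod.induct)
      case (prod p q)
      then obtain a b where ab: "a \<in> carrier R" "b \<in> carrier R" "q = a \<otimes> u \<oplus> b \<otimes> y"
        using u y unfolding I by (auto simp: Idl_pair)
      obtain c h where ch: "c \<in> carrier R" "h \<in> ideal_pow R I n" "p = c \<otimes> y [^] Suc n \<oplus> u \<otimes> h"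
        using Suc.IH[OF prod(1)] by blast
      have h: "h \<in> carrier R" using ch(2) ideal.Icarr[OF ideal_ideal_pow[OF I']] by blast
      have p: "p \<in> carrier R" using prod(1) by (rule P.Icarr)
      have "y \<otimes> h \<in> ?P" using ideal_pow_mult_Suc[OF yI ch(2) I'] .
      then have m: "a \<otimes> p \<oplus> b \<otimes> (y \<otimes> h) \<in> ?P" using ab prod(1) P.I_l_closed P.a_closed by blast
      \<comment> \<open>The new factor \<open>q\<close> contributes a multiple of \<open>u\<close>
        and a multiple of \<open>y\<close>; only the latter reaches the leading term and raises its
        exponent.\<close>
      have "p \<otimes> q = u \<otimes> (a \<otimes> p) \<oplus> b \<otimes> y \<otimes> p"
        using ab p u y by (simp add: r_distr m_ac)
      also have "b \<otimes> y \<otimes> p = (b \<otimes> c) \<otimes> y [^] Suc (Suc n) \<oplus> u \<otimes> (b \<otimes> (y \<otimes> h))"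
        unfolding ch(3) using ab ch(1) h u y by (simp add: r_distr m_ac)
      finally have "p \<otimes> q = (b \<otimes> c) \<otimes> y [^] Suc (Suc n) \<oplus> u \<otimes> (a \<otimes> p \<oplus> b \<otimes> (y \<otimes> h))"
        using ab ch(1) h p u y by (simp add: r_distr a_ac)
      then show ?case using m ab ch(1) by blast
    next
      case (sum s t)
      then obtain c h c' h' where *: "c \<in> carrier R" "h \<in> ?P" "s = c \<otimes> y [^] Suc (Suc n) \<oplus> u \<otimes> h"
        "c' \<in> carrier R" "h' \<in> ?P" "t = c' \<otimes> y [^] Suc (Suc n) \<oplus> u \<otimes> h'" by blast
      have "s \<oplus> t = (c \<oplus> c') \<otimes> y [^] Suc (Suc n) \<oplus> u \<otimes> (h \<oplus> h')"
        using *(1,4) P.Icarr[OF *(2)] P.Icarr[OF *(5)] u y unfolding *(3,6)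
        by (simp add: r_distr l_distr a_ac del: nat_pow_Suc)
      then show ?case using * by blast
    qed
  qed
  then show ?thesis using that by blast
qed

lemma (in cring) ideal_pow_decomp_mem:
  assumes "ideal I R" "y \<in> I" "u \<in> I" "c \<in> carrier R" "h \<in> ideal_pow R I n"
  shows "c \<otimes> y [^] Suc n \<oplus> u \<otimes> h \<in> ideal_pow R I (Suc n)"
proof -
  interpret P: ideal "ideal_pow R I (Suc n)" R by (rule ideal_ideal_pow[OF assms(1)])
  show ?thesis
    using P.I_l_closed[OF nat_pow_in_ideal_pow[OF assms(1,2)] assms(4)]
      ideal_pow_mult_Suc[OF assms(3,5,1)] by (rule P.a_closed)
qed

lemma (in cring) Idl_pair_shift:
  assumes "x \<in> carrier R" "y \<in> carrier R" "l \<in> carrier R"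
  shows "Idl {x \<oplus> l \<otimes> y, y} = Idl {x, y}"
proof
  have *: "x \<in> Idl {x,y}" "y \<in> Idl {x,y}" "x \<oplus> l \<otimes> y \<in> Idl {x \<oplus> l \<otimes> y, y}" "y \<in> Idl {x \<oplus> l \<otimes> y, y}"
    using genideal_self[of "{x,y}"] genideal_self[of "{x \<oplus> l \<otimes> y,y}"] assms by auto
  interpret J: ideal "Idl {x,y}" R by (rule genideal_ideal) (use assms in auto)
  interpret K: ideal "Idl {x \<oplus> l \<otimes> y, y}" R by (rule genideal_ideal) (use assms in auto)
  show "Idl {x \<oplus> l \<otimes> y, y} \<subseteq> Idl {x, y}"
    by (rule genideal_minimal[OF J.is_ideal]) (use * assms in \<open>auto intro: J.I_l_closed\<close>)
  have "x = (x \<oplus> l \<otimes> y) \<oplus> (\<ominus> l) \<otimes> y" using assms by algebra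
  then have "x \<in> Idl {x \<oplus> l \<otimes> y, y}" using *(3,4) assms K.I_l_closed K.a_closed by (metis a_inv_closed)
  then show "Idl {x, y} \<subseteq> Idl {x \<oplus> l \<otimes> y, y}"
    by (intro genideal_minimal[OF K.is_ideal]) (use * in auto)
qed

text \<open>The factor \<open>a\<close> is absorbed by \<open>J\<close>. With \<open>J\<close> a
  power of \<open>I\<close> this raises the exponent by one; together with the mirrored version it
  carries both summands of the theorem from \<open>n\<close> to \<open>Suc n\<close>.\<close>

lemma (in cring) mult_mem_ideal_prod_left:
  assumes "ideal J R" "ideal I R" "ideal N R" and a: "a \<in> I" and p: "p \<in> J \<cdot> N"
  shows "a \<otimes> p \<in> (J \<cdot> I) \<cdot> N"
proof -
  have "p \<otimes> a \<in> (J \<cdot> N) \<cdot> I" using p a by (rule ideal_prod.prod)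
  moreover have "(J \<cdot> N) \<cdot> I = (J \<cdot> I) \<cdot> N"
    using assms(1-3) by (simp add: ideal_prod_assoc ideal_prod_commute[of N I])
  moreover have "p \<in> carrier R" "a \<in> carrier R"
    using p a ideal_prod_in_carrier[OF assms(1,3)] ideal.Icarr[OF assms(2)] by auto
  ultimately show ?thesis by (simp add: m_comm)
qed

lemma (in cring) mult_mem_ideal_prod_right:
  assumes "ideal J R" "ideal I R" "ideal N R" and a: "a \<in> I" and p: "p \<in> N \<cdot> J"
  shows "a \<otimes> p \<in> N \<cdot> (J \<cdot> I)"
  using mult_mem_ideal_prod_left[OF assms(1-4)] p assms(1-3)
  by (simp add: ideal_prod_commute ideal_prod_is_ideal)

lemma (in cring) ideal_pow_add:
  assumes "ideal I R"
  shows "ideal_pow R I (m + n) = ideal_pow R I m \<cdot> ideal_pow R I n"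
  by (induction n) (simp_all add: assms ideal_prod_one ideal_ideal_pow ideal_prod_assoc)


section \<open>General linear combinations of the generators\<close>

text \<open>
  A form of degree \<open>n\<close> in the generators \<open>u, y\<close> of \<open>I\<close> takes a value \<open>c y\<^sup>n + u h\<close> with
  \<open>h \<in> I\<^bsup>n-1\<^esup>\<close>; the condition is that \<open>c\<close> can be chosen outside \<open>P\<close>. For \<open>n = 0\<close> only
  \<open>h = 0\<close> is allowed.
\<close>

definition monic_form :: "('a, 'b) ring_scheme \<Rightarrow> 'a set \<Rightarrow> 'a set \<Rightarrow> 'a \<Rightarrow> 'a \<Rightarrow> nat \<Rightarrow> 'a \<Rightarrow> bool" where
  "monic_form R P I u y n f \<longleftrightarrow>
     (\<exists>c \<in> carrier R - P. \<exists>h \<in> (case n of 0 \<Rightarrow> {\<zero>\<^bsub>R\<^esub>} | Suc k \<Rightarrow> ideal_pow R I k).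
        f = c \<otimes>\<^bsub>R\<^esub> y [^]\<^bsub>R\<^esub> n \<oplus>\<^bsub>R\<^esub> u \<otimes>\<^bsub>R\<^esub> h)"

text \<open>
  This replaces the count of the roots, modulo \<open>P\<close>, of a polynomial in \<open>l\<close>: splitting off
  \<open>x + l y\<close> for one \<open>l\<close> from \<open>f\<close> leaves an element of a lower power of \<open>I\<close> which is not monic
  for the other \<open>l\<close> either.
\<close>

lemma (in cring) not_monic_form_imp_mem_mult:
  assumes P: "primeideal P R" and x: "x \<in> carrier R" and y: "y \<in> carrier R" and I: "I = Idl {x, y}"
    and f: "f \<in> ideal_pow R I n"
    and L: "infinite L" "L \<subseteq> carrier R"
    and diff: "\<And>k l. k \<in> L \<Longrightarrow> l \<in> L \<Longrightarrow> k \<noteq> l \<Longrightarrow> k \<ominus> l \<notin> P"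
    and nm: "\<And>l. l \<in> L \<Longrightarrow> \<not> monic_form R P I (x \<oplus> l \<otimes> y) y n f"
  shows "f \<in> P \<cdot> ideal_pow R I n"
  using f L diff nm
proof (induction n arbitrary: f L)
  case 0
  interpret P: primeideal P R by (rule P)
  obtain l where l: "l \<in> L" "l \<in> carrier R" using 0 by (metis finite.emptyI ex_in_conv subsetD)
  have "f \<in> P"
  proof (rule ccontr)
    assume "f \<notin> P"
    then have "monic_form R P I (x \<oplus> l \<otimes> y) y 0 f"
      using 0(1) l x y unfolding monic_form_def by auto
    then show False using 0(5) l by blast
  qed
  then show ?case using ideal_prod_one[OF P.is_ideal] by simp
next
  case (Suc n)
  interpret P: primeideal P R by (rule P)
  have I': "ideal I R" unfolding I by (rule genideal_ideal) (use x y in auto)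
  have yI: "y \<in> I" and xI: "x \<in> I" using genideal_self[of "{x,y}"] x y by (auto simp: I)
  \<comment> \<open>Any one \<open>l\<close> serves to split \<open>f\<close>; the others form a set
    that is still infinite and is handed to the induction hypothesis for \<open>g\<close>.\<close>
  obtain l where l: "l \<in> L" "l \<in> carrier R" using Suc.prems by (metis finite.emptyI ex_in_conv subsetD)
  let ?u = "\<lambda>l. x \<oplus> l \<otimes> y"
  obtain c g where cg: "c \<in> carrier R" "g \<in> ideal_pow R I n" "f = c \<otimes> y [^] Suc n \<oplus> ?u l \<otimes> g"
    using mem_ideal_pow_SucE[of "?u l" y I f n] Suc.prems(1) Idl_pair_shift[OF x y l(2)] x y l I
    by auto
  interpret Q: ideal "ideal_pow R I n" R by (rule ideal_ideal_pow[OF I'])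
  interpret PQ: ideal "P \<cdot> ideal_pow R I (Suc n)" R
    by (intro ideal_prod_is_ideal P.is_ideal ideal_ideal_pow I')
  have cP: "c \<in> P"
  proof (rule ccontr)
    assume "c \<notin> P"
    then have "monic_form R P I (?u l) y (Suc n) f" using cg unfolding monic_form_def by auto
    with Suc.prems(5) l show False by blast
  qed
  have "g \<in> P \<cdot> ideal_pow R I n"
  proof (rule Suc.IH[OF cg(2), of "L - {l}"])
    show "infinite (L - {l})" "L - {l} \<subseteq> carrier R" using Suc.prems by auto
    fix k k' assume "k \<in> L - {l}" "k' \<in> L - {l}" "k \<noteq> k'"
    then show "k \<ominus> k' \<notin> P" using Suc.prems by blast
  next
    fix k assume k: "k \<in> L - {l}"
    then have kc: "k \<in> carrier R" using Suc.prems by auto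
    have d: "l \<ominus> k \<notin> P" using Suc.prems(4) k l by auto
    show "\<not> monic_form R P I (?u k) y n g"
    proof
      assume "monic_form R P I (?u k) y n g"
      then obtain b h where b: "b \<in> carrier R" "b \<notin> P" "g = b \<otimes> y [^] n \<oplus> ?u k \<otimes> h"
        and h: "h \<in> (case n of 0 \<Rightarrow> {\<zero>} | Suc k \<Rightarrow> ideal_pow R I k)"
        unfolding monic_form_def by auto
      have h': "h \<in> carrier R" "y \<otimes> h \<in> ideal_pow R I n"
        using h ideal_pow_mult_Suc[OF yI _ I'] ideal.Icarr[OF ideal_ideal_pow[OF I']] y
        by (auto split: nat.splits)
      let ?e = "l \<ominus> k"
      have e: "?e \<in> carrier R" using l kc by simp
      \<comment> \<open>Replacing \<open>?u l\<close> by \<open>?u k\<close> turns \<open>f\<close>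
        into a form in \<open>?u k\<close> and \<open>y\<close>. If \<open>g\<close> has leading
        coefficient \<open>b\<close> there, then \<open>f\<close> has leading coefficient
        \<open>c \<oplus> ?e \<otimes> b\<close>.\<close>
      have ul: "?u l = ?u k \<oplus> ?e \<otimes> y" using l kc x y by algebra
      have g: "g \<in> carrier R" using cg(2) by (rule Q.Icarr)
      have uk: "?u k \<in> carrier R" using x y kc by simp
      have "?u l \<otimes> g = ?u k \<otimes> g \<oplus> (?e \<otimes> y) \<otimes> g"
        unfolding ul using uk e y g by (simp only: l_distr m_closed)
      also have "(?e \<otimes> y) \<otimes> g = (?e \<otimes> b) \<otimes> y [^] Suc n \<oplus> ?u k \<otimes> (?e \<otimes> (y \<otimes> h))"
      proof -
        have "\<And>w. w \<in> carrier R \<Longrightarrow> (?e \<otimes> y) \<otimes> (b \<otimes> y [^] n \<oplus> w \<otimes> h) = (?e \<otimes> b) \<otimes> y [^] Suc n \<oplus> w \<otimes> (?e \<otimes> (y \<otimes> h))"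
          using e y b(1) h' by (simp add: r_distr m_ac)
        then show ?thesis unfolding b(3) using uk by blast
      qed
      finally have 1: "f = c \<otimes> y [^] Suc n \<oplus> (?u k \<otimes> g \<oplus> ((?e \<otimes> b) \<otimes> y [^] Suc n \<oplus> ?u k \<otimes> (?e \<otimes> (y \<otimes> h))))"
        unfolding cg(3) by simp
      have "\<And>w Y. w \<in> carrier R \<Longrightarrow> Y \<in> carrier R \<Longrightarrow> c \<otimes> Y \<oplus> (w \<otimes> g \<oplus> ((?e \<otimes> b) \<otimes> Y \<oplus> w \<otimes> (?e \<otimes> (y \<otimes> h))))
           = (c \<oplus> ?e \<otimes> b) \<otimes> Y \<oplus> w \<otimes> (g \<oplus> ?e \<otimes> (y \<otimes> h))"
        using cg(1) g e b(1) y h'(1) by (simp add: r_distr l_distr a_ac m_ac)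
      with 1 uk y have 2: "f = (c \<oplus> ?e \<otimes> b) \<otimes> y [^] Suc n \<oplus> ?u k \<otimes> (g \<oplus> ?e \<otimes> (y \<otimes> h))" by simp
      \<comment> \<open>Primality enters here: \<open>c\<close> lies in \<open>P\<close>, while
        neither \<open>?e\<close> nor \<open>b\<close> does.\<close>
      have "c \<oplus> ?e \<otimes> b \<notin> P"
      proof
        assume "c \<oplus> ?e \<otimes> b \<in> P"
        then have "(c \<oplus> ?e \<otimes> b) \<ominus> c \<in> P" using cP by (simp add: minus_eq)
        moreover have "(c \<oplus> ?e \<otimes> b) \<ominus> c = ?e \<otimes> b" using cg(1) e b(1) l kc by algebra
        ultimately show False using P.I_prime[OF e b(1)] d b(2) by auto
      qed
      moreover have "g \<oplus> ?e \<otimes> (y \<otimes> h) \<in> ideal_pow R I n"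
        using cg(2) h'(2) e by (simp add: Q.I_l_closed)
      ultimately have "monic_form R P I (?u k) y (Suc n) f"
        unfolding monic_form_def using 2 cg(1) e b(1) by (auto intro!: bexI)
      then show False using Suc.prems(5) k by blast
    qed
  qed
  then have "g \<otimes> ?u l \<in> (P \<cdot> ideal_pow R I n) \<cdot> I"
    by (rule ideal_prod.prod) (use xI yI l in \<open>simp add: ideal.I_l_closed[OF I'] additive_subgroup.a_closed[OF ideal.axioms(1)[OF I']]\<close>)
  then have "?u l \<otimes> g \<in> P \<cdot> ideal_pow R I (Suc n)"
    using ideal_prod_assoc[OF P.is_ideal Q.is_ideal I'] Q.Icarr[OF cg(2)] x y l by (simp add: m_comm)
  moreover have "c \<otimes> y [^] Suc n \<in> P \<cdot> ideal_pow R I (Suc n)"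
    by (rule ideal_prod.prod[OF cP nat_pow_in_ideal_pow[OF I' yI]])
  ultimately show ?case unfolding cg(3) by (intro PQ.a_closed)
qed

text \<open>
  If \<open>(x + l\<^sub>k y) s\<^sub>k \<in> J\<close> with \<open>s\<^sub>k \<notin> J\<close> for all \<open>k\<close>, the \<open>s\<^sub>k\<close> behave like eigenvectors for
  different eigenvalues: the chain of the ideals \<open>J : \<Prod>\<^sub>j\<^sub><\<^sub>k (x + l\<^sub>j y)\<close> becomes stationary, and
  modulo \<open>J\<close> the product acts on \<open>s\<^sub>k\<close> as a unit times \<open>y\<^sup>k\<close>. So \<open>y\<^sup>k s\<^sub>k \<in> J\<close>, and the last
  \<open>y\<^sup>m s\<^sub>k \<notin> J\<close> is annihilated modulo \<open>J\<close> by \<open>x\<close> and \<open>y\<close>.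
\<close>

lemma exists_regular_combination:
  fixes R (structure)
  assumes "cring R" and "noetherian_ring R" and J: "ideal J R"
    and x: "x \<in> carrier R" and y: "y \<in> carrier R"
    and i: "i \<in> Idl {x, y}" "\<And>g. g \<in> carrier R \<Longrightarrow> i \<otimes> g \<in> J \<Longrightarrow> g \<in> J"
    and L: "infinite L" "L \<subseteq> carrier R"
    and diff: "\<And>k l. k \<in> L \<Longrightarrow> l \<in> L \<Longrightarrow> k \<noteq> l \<Longrightarrow> k \<ominus> l \<in> Units R"
  shows "\<exists>l\<in>L. \<forall>g\<in>carrier R. (x \<oplus> l \<otimes> y) \<otimes> g \<in> J \<longrightarrow> g \<in> J"
proof (rule ccontr)
  assume contr: "\<not> (\<exists>l\<in>L. \<forall>g\<in>carrier R. (x \<oplus> l \<otimes> y) \<otimes> g \<in> J \<longrightarrow> g \<in> J)"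
  interpret cring R by fact
  interpret noetherian_ring R by fact
  interpret J: ideal J R by (rule J)
  obtain ls :: "nat \<Rightarrow> 'a" where ls: "inj ls" "range ls \<subseteq> L" using infinite_countable_subset[OF L(1)] by blast
  have lsc [simp]: "ls k \<in> carrier R" for k using ls(2) L(2) by auto
  define u where "u k = x \<oplus> ls k \<otimes> y" for k
  have uc [simp]: "u k \<in> carrier R" for k using x y by (simp add: u_def)
  define P where "P = rec_nat \<one> (\<lambda>k p. u k \<otimes> p)"
  have P0: "P 0 = \<one>" and PS: "P (Suc k) = u k \<otimes> P k" for k by (simp_all add: P_def)
  have Pc [simp]: "P k \<in> carrier R" for k by (induction k) (simp_all add: P0 PS)
  \<comment> \<open>The colon ideal \<open>J : P k\<close>; it grows with \<open>k\<close> because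
    \<open>P k\<close> divides \<open>P (Suc k)\<close>.\<close>
  define Q where "Q k = {g \<in> carrier R. P k \<otimes> g \<in> J}" for k
  have Qi: "ideal (Q k) R" for k
  proof (rule idealI[OF ring_axioms])
    show "subgroup (Q k) (add_monoid R)"
    proof (rule add.subgroupI)
      have "\<zero> \<in> Q k" by (simp add: Q_def)
      then show "Q k \<noteq> {}" by blast
    qed (auto simp: Q_def r_distr r_minus)
    fix a g assume "a \<in> Q k" "g \<in> carrier R"
    then show "g \<otimes> a \<in> Q k" "a \<otimes> g \<in> Q k"
      using J.I_l_closed[of "P k \<otimes> a" g] by (auto simp: Q_def m_ac)
  qed
  have Qm: "Q k \<subseteq> Q (Suc k)" for k
    by (auto simp: Q_def PS m_assoc J.I_l_closed)
  have Qle: "Q j \<subseteq> Q k" if "j \<le> k" for j k using lift_Suc_mono_le[of Q, OF Qm that] .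
  have "Q j \<subseteq> Q k \<or> Q k \<subseteq> Q j" for j k using Qle nat_le_linear by blast
  then have Qch: "\<forall>A\<in>range Q. \<forall>B\<in>range Q. A \<subset> B \<or> A = B \<or> B \<subset> A" by blast
  have "\<Union>(range Q) \<in> range Q"
  proof (rule ideal_chain_is_trivial)
    show "subset.chain {I. ideal I R} (range Q)"
      unfolding pred_on.chain_def using Qi Qch by auto
  qed simp
  \<comment> \<open>From \<open>k\<close> on the chain is constant. The element \<open>g\<close>
    below is taken for the factor \<open>u k\<close>, so that \<open>P (Suc k)\<close> and hence
    already \<open>P k\<close> multiplies it into \<open>J\<close>.\<close>
  then obtain k where k: "\<Union>(range Q) = Q k" by auto
  obtain g where g: "g \<in> carrier R" "u k \<otimes> g \<in> J" "g \<notin> J"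
  proof -
    have "ls k \<in> L" using ls(2) by blast
    then have "\<not> (\<forall>g\<in>carrier R. u k \<otimes> g \<in> J \<longrightarrow> g \<in> J)" using contr unfolding u_def by blast
    then show ?thesis using that by blast
  qed
  have "g \<in> Q (Suc k)"
    using g(1) J.I_l_closed[OF g(2), of "P k"] by (simp add: Q_def PS m_ac)
  then have Pg: "P k \<otimes> g \<in> J" using k by (auto simp: Q_def)
  \<comment> \<open>Modulo \<open>J\<close>, \<open>u k\<close> annihilates \<open>g\<close>, so
    \<open>u j\<close> acts on it as \<open>(ls j \<ominus> ls k) \<otimes> y\<close>. The
    differences are units as long as \<open>j < k\<close>, and \<open>e\<close> collects their
    product.\<close>
  have "\<exists>e\<in>Units R. P j \<otimes> g \<ominus> e \<otimes> (y [^] j \<otimes> g) \<in> J" if "j \<le> k" for j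
    using that
  proof (induction j)
    case 0
    then show ?case using g(1) by (auto intro!: bexI[of _ \<one>] simp: P0 minus_eq r_neg)
  next
    case (Suc j)
    then obtain e where e: "e \<in> Units R" "P j \<otimes> g \<ominus> e \<otimes> (y [^] j \<otimes> g) \<in> J" by auto
    let ?d = "ls j \<ominus> ls k"
    have d: "?d \<in> Units R" using Suc.prems ls by (intro diff) (auto dest: injD)
    have ec: "e \<in> carrier R" using e(1) by (rule Units_closed)
    let ?Y = "y [^] j"
    have Yc: "?Y \<in> carrier R" using y by simp
    have "P (Suc j) \<otimes> g \<ominus> (?d \<otimes> e) \<otimes> (y [^] Suc j \<otimes> g)
        = u j \<otimes> (P j \<otimes> g \<ominus> e \<otimes> (?Y \<otimes> g)) \<oplus> (e \<otimes> ?Y) \<otimes> (u k \<otimes> g)"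
    proof -
      \<comment> \<open>To be read with \<open>v\<close> as \<open>u j\<close>, \<open>p\<close> as
        \<open>P j\<close>, \<open>Y\<close> as \<open>y [^] j\<close> and \<open>c\<close> as
        \<open>?d\<close>; then \<open>v \<ominus> c \<otimes> y\<close> is
        \<open>u k\<close>.\<close>
      have 1: "(v \<otimes> p) \<otimes> g \<ominus> (c \<otimes> e) \<otimes> ((Y \<otimes> y) \<otimes> g)
        = v \<otimes> (p \<otimes> g \<ominus> e \<otimes> (Y \<otimes> g)) \<oplus> (e \<otimes> Y) \<otimes> ((v \<ominus> c \<otimes> y) \<otimes> g)"
        if c: "v \<in> carrier R" "Y \<in> carrier R" "p \<in> carrier R" "c \<in> carrier R" for v Y p c
      proof -
        have tele: "(a1 \<ominus> a2) \<oplus> (a2 \<ominus> a3) = a1 \<ominus> a3"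
          if "a1 \<in> carrier R" "a2 \<in> carrier R" "a3 \<in> carrier R" for a1 a2 a3
          using that by algebra
        have "v \<otimes> (p \<otimes> g \<ominus> e \<otimes> (Y \<otimes> g)) = (v \<otimes> p) \<otimes> g \<ominus> v \<otimes> (e \<otimes> (Y \<otimes> g))"
          using c g(1) ec by (simp add: minus_eq r_distr r_minus m_assoc)
        moreover have "(e \<otimes> Y) \<otimes> ((v \<ominus> c \<otimes> y) \<otimes> g) = v \<otimes> (e \<otimes> (Y \<otimes> g)) \<ominus> (c \<otimes> e) \<otimes> ((Y \<otimes> y) \<otimes> g)"
          using c g(1) ec y by (simp add: minus_eq r_distr l_distr r_minus l_minus m_ac)
        ultimately show ?thesis using c g(1) ec y by (simp add: tele)
      qed
      have "u k = u j \<ominus> ?d \<otimes> y"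
      proof -
        have "ls j \<in> carrier R" "ls k \<in> carrier R" by simp_all
        with x y show ?thesis unfolding u_def by algebra
      qed
      then show ?thesis using 1[of "u j" ?Y "P j" ?d] y by (simp add: PS)
    qed
    also have "\<dots> \<in> J" using e(2) g(2) ec Yc by (simp add: J.I_l_closed)
    finally show ?case using e(1) d by (intro bexI[of _ "?d \<otimes> e"]) auto
  qed
  from this[of k] obtain e where e: "e \<in> Units R" "P k \<otimes> g \<ominus> e \<otimes> (y [^] k \<otimes> g) \<in> J" by auto
  have ec: "e \<in> carrier R" using e(1) by (rule Units_closed)
  have "P k \<otimes> g \<ominus> (P k \<otimes> g \<ominus> e \<otimes> (y [^] k \<otimes> g)) \<in> J" using Pg e(2) by (simp add: minus_eq)
  moreover have "p \<ominus> (p \<ominus> q) = q" if "p \<in> carrier R" "q \<in> carrier R" for p q using that by algebra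
  ultimately have "e \<otimes> (y [^] k \<otimes> g) \<in> J" using g(1) ec y by simp
  then have "inv e \<otimes> (e \<otimes> (y [^] k \<otimes> g)) \<in> J" using e(1) by (simp add: J.I_l_closed)
  then have "y [^] k \<otimes> g \<in> J" using e(1) ec y g(1) by (simp add: m_assoc[symmetric])
  then have ex: "\<exists>m::nat. y [^] m \<otimes> g \<in> J" by blast
  \<comment> \<open>The exponent just before the least one gives an element \<open>?t\<close>
    outside \<open>J\<close> that \<open>y\<close> multiplies into \<open>J\<close>. It exists
    because at exponent zero \<open>g\<close> itself is outside \<open>J\<close>.\<close>
  define m where "m = (LEAST m::nat. y [^] m \<otimes> g \<in> J)"
  have m: "y [^] m \<otimes> g \<in> J" unfolding m_def by (rule LeastI_ex[OF ex])
  have "m \<noteq> 0"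
  proof
    assume "m = 0"
    with m g(1,3) show False by simp
  qed
  then obtain m' where m': "m = Suc m'" by (cases m) auto
  let ?t = "y [^] m' \<otimes> g"
  have t: "?t \<notin> J" "?t \<in> carrier R" using not_less_Least[of m' "\<lambda>m::nat. y [^] m \<otimes> g \<in> J"] m' m_def y g(1) by auto
  have yt: "y \<otimes> ?t \<in> J" using m y g(1) by (simp add: m' m_ac)
  have "u k \<otimes> ?t \<ominus> ls k \<otimes> (y \<otimes> ?t) \<in> J"
    using J.I_l_closed[OF g(2), of "y [^] m'"] yt y g(1) J.I_l_closed[OF yt, of "ls k"] by (simp add: minus_eq m_lcomm)
  moreover have "u k \<otimes> ?t \<ominus> ls k \<otimes> (y \<otimes> ?t) = x \<otimes> ?t"
  proof -
    have "ls k \<in> carrier R" by simp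
    with x y t(2) show ?thesis unfolding u_def by algebra
  qed
  ultimately have xt: "x \<otimes> ?t \<in> J" by simp
  obtain a b where ab: "a \<in> carrier R" "b \<in> carrier R" "i = a \<otimes> x \<oplus> b \<otimes> y"
    using i(1) x y by (auto simp: Idl_pair)
  \<comment> \<open>Since \<open>x\<close> and \<open>y\<close> annihilate \<open>?t\<close> modulo
    \<open>J\<close>, so does \<open>i\<close>, against its regularity.\<close>
  have "i \<otimes> ?t = a \<otimes> (x \<otimes> ?t) \<oplus> b \<otimes> (y \<otimes> ?t)"
    unfolding ab(3) using ab(1,2) x y t(2) by algebra
  also have "\<dots> \<in> J" using xt yt ab(1,2) by (simp add: J.I_l_closed)
  finally show False using i(2) t by blast
qed


section \<open>Integral equations and elements of the ideal powers\<close>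

text \<open>Gathering the values in one set hides the coefficient families, so that inductions on
  the degree can split off the top term.\<close>

definition low_polys :: "('a, 'b) ring_scheme \<Rightarrow> 'a set \<Rightarrow> 'a \<Rightarrow> nat \<Rightarrow> 'a set" where
  "low_polys S K w n =
     {\<Oplus>\<^bsub>S\<^esub>i\<in>{..<n}. c i \<otimes>\<^bsub>S\<^esub> w [^]\<^bsub>S\<^esub> i | c. \<forall>i<n. c i \<in> K}"

lemma monic_root_low_polys:
  "monic_root S K n w \<longleftrightarrow> (\<exists>s\<in>low_polys S K w n. w [^]\<^bsub>S\<^esub> n \<oplus>\<^bsub>S\<^esub> s = \<zero>\<^bsub>S\<^esub>)"
  by (auto simp: monic_root_def low_polys_def)

lemma (in cring) low_polys_0: "low_polys R K w 0 = {\<zero>}"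
  by (auto simp: low_polys_def)

lemma (in cring) low_polys_Suc:
  assumes K: "K \<subseteq> carrier R" and w: "w \<in> carrier R"
  shows "low_polys R K w (Suc n) = {s \<oplus> c \<otimes> w [^] n | s c. s \<in> low_polys R K w n \<and> c \<in> K}"
proof -
  have *: "(\<Oplus>i\<in>{..<Suc n}. c i \<otimes> w [^] i) = (\<Oplus>i\<in>{..<n}. c i \<otimes> w [^] i) \<oplus> c n \<otimes> w [^] n"
    if "\<forall>i<Suc n. c i \<in> K" for c
  proof -
    have "(\<lambda>i. c i \<otimes> w [^] i) \<in> {..<n} \<rightarrow> carrier R" "c n \<otimes> w [^] n \<in> carrier R"
      using that K w by (auto simp: subset_iff)
    then show ?thesis unfolding lessThan_Suc by (subst finsum_insert) (auto simp: a_comm)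
  qed
  show ?thesis
  proof (intro equalityI subsetI)
    fix z assume "z \<in> low_polys R K w (Suc n)"
    then obtain c where c: "\<forall>i<Suc n. c i \<in> K" "z = (\<Oplus>i\<in>{..<Suc n}. c i \<otimes> w [^] i)"
      unfolding low_polys_def by blast
    then have "\<forall>i<n. c i \<in> K" "c n \<in> K" by auto
    then show "z \<in> {s \<oplus> c \<otimes> w [^] n | s c. s \<in> low_polys R K w n \<and> c \<in> K}"
      unfolding c(2) *[OF c(1)] low_polys_def by blast
  next
    fix z assume "z \<in> {s \<oplus> c \<otimes> w [^] n | s c. s \<in> low_polys R K w n \<and> c \<in> K}"
    then obtain c b where c: "\<forall>i<n. c i \<in> K" "b \<in> K" "z = (\<Oplus>i\<in>{..<n}. c i \<otimes> w [^] i) \<oplus> b \<otimes> w [^] n"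
      unfolding low_polys_def by blast
    let ?c = "c(n := b)"
    have c': "\<forall>i<Suc n. ?c i \<in> K" using c by (auto simp: less_Suc_eq)
    have "(\<Oplus>i\<in>{..<n}. c i \<otimes> w [^] i) = (\<Oplus>i\<in>{..<n}. ?c i \<otimes> w [^] i)"
      using c K w by (intro finsum_cong') auto
    then have "z = (\<Oplus>i\<in>{..<Suc n}. ?c i \<otimes> w [^] i)" unfolding *[OF c'] c(3) by simp
    then show "z \<in> low_polys R K w (Suc n)" using c' unfolding low_polys_def by blast
  qed
qed

lemma (in cring) low_polys_closed:
  "K \<subseteq> carrier R \<Longrightarrow> w \<in> carrier R \<Longrightarrow> low_polys R K w n \<subseteq> carrier R"
  by (induction n) (auto simp: low_polys_0 low_polys_Suc)

text \<open>This is dehomogenisation: as \<open>h y\<close> is \<open>w\<close> times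
  \<open>h u\<close>, a monomial of degree \<open>n\<close> with \<open>y\<close>-exponent
  \<open>i\<close> goes to the \<open>n\<close>-th power of \<open>h u\<close> times the
  \<open>i\<close>-th power of \<open>w\<close>. Exponents \<open>0\<close> to \<open>n\<close>
  occur, hence \<open>Suc n\<close> coefficients.\<close>

lemma (in ring_hom_cring) ideal_pow_image:
  assumes u: "u \<in> carrier R" and y: "y \<in> carrier R" and I: "I = Idl\<^bsub>R\<^esub> {u, y}"
    and w: "w \<in> carrier S" "h y = w \<otimes>\<^bsub>S\<^esub> h u"
  shows "h ` ideal_pow R I n = (\<lambda>s. h u [^]\<^bsub>S\<^esub> n \<otimes>\<^bsub>S\<^esub> s) ` low_polys S (h ` carrier R) w (Suc n)"
proof -
  let ?K = "h ` carrier R"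
  have K: "?K \<subseteq> carrier S" by auto
  show ?thesis
  proof (induction n)
    case 0
    have "low_polys S ?K w (Suc 0) = ?K"
    proof -
      have "\<zero>\<^bsub>S\<^esub> \<oplus>\<^bsub>S\<^esub> c \<otimes>\<^bsub>S\<^esub> w [^]\<^bsub>S\<^esub> (0::nat) = c" if "c \<in> ?K" for c
        using that K by auto
      then show ?thesis unfolding S.low_polys_Suc[OF K w(1)] S.low_polys_0 by force
    qed
    moreover have "(\<lambda>s. h u [^]\<^bsub>S\<^esub> (0::nat) \<otimes>\<^bsub>S\<^esub> s) ` ?K = ?K"
      using K by (force simp: image_iff)
    ultimately show ?case by simp
  next
    case (Suc n)
    have I': "ideal I R" unfolding I by (rule R.genideal_ideal) (use u y in auto)
    have uI: "u \<in> I" "y \<in> I" using R.genideal_self[of "{u,y}"] u y by (auto simp: I)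
    have hu: "h u \<in> carrier S" using u by simp
    \<comment> \<open>Both inclusions use this: the pure power of \<open>y\<close> in the form
      corresponds to the top term in \<open>w\<close>.\<close>
    have key: "h (c \<otimes> y [^] Suc n \<oplus> u \<otimes> g) = h u [^]\<^bsub>S\<^esub> Suc n \<otimes>\<^bsub>S\<^esub> (s \<oplus>\<^bsub>S\<^esub> h c \<otimes>\<^bsub>S\<^esub> w [^]\<^bsub>S\<^esub> Suc n)"
      if "c \<in> carrier R" "g \<in> ideal_pow R I n" "s \<in> carrier S" "h g = h u [^]\<^bsub>S\<^esub> n \<otimes>\<^bsub>S\<^esub> s" for c g s
    proof -
      have g: "g \<in> carrier R" using that(2) R.ideal_ideal_pow[OF I'] ideal.Icarr by metis
      have "h (c \<otimes> y [^] Suc n \<oplus> u \<otimes> g) = h c \<otimes>\<^bsub>S\<^esub> (w \<otimes>\<^bsub>S\<^esub> h u) [^]\<^bsub>S\<^esub> Suc n \<oplus>\<^bsub>S\<^esub> h u \<otimes>\<^bsub>S\<^esub> (h u [^]\<^bsub>S\<^esub> n \<otimes>\<^bsub>S\<^esub> s)"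
        using that(1) g y u by (simp add: hom_nat_pow w(2) that(4) del: R.nat_pow_Suc S.nat_pow_Suc)
      also have "(w \<otimes>\<^bsub>S\<^esub> h u) [^]\<^bsub>S\<^esub> Suc n = w [^]\<^bsub>S\<^esub> Suc n \<otimes>\<^bsub>S\<^esub> h u [^]\<^bsub>S\<^esub> Suc n"
        using w(1) hu by (rule S.nat_pow_distrib)
      also have "h c \<otimes>\<^bsub>S\<^esub> (w [^]\<^bsub>S\<^esub> Suc n \<otimes>\<^bsub>S\<^esub> h u [^]\<^bsub>S\<^esub> Suc n) \<oplus>\<^bsub>S\<^esub> h u \<otimes>\<^bsub>S\<^esub> (h u [^]\<^bsub>S\<^esub> n \<otimes>\<^bsub>S\<^esub> s)
        = h u [^]\<^bsub>S\<^esub> Suc n \<otimes>\<^bsub>S\<^esub> (s \<oplus>\<^bsub>S\<^esub> h c \<otimes>\<^bsub>S\<^esub> w [^]\<^bsub>S\<^esub> Suc n)"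
        using that(1,3) w(1) hu by (simp add: S.r_distr S.m_ac S.a_ac)
      finally show ?thesis .
    qed
    show ?case
    proof (intro equalityI subsetI)
      fix z assume "z \<in> h ` ideal_pow R I (Suc n)"
      then obtain f where f: "f \<in> ideal_pow R I (Suc n)" "z = h f" by blast
      obtain c g where cg: "c \<in> carrier R" "g \<in> ideal_pow R I n" "f = c \<otimes> y [^] Suc n \<oplus> u \<otimes> g"
        using R.mem_ideal_pow_SucE[OF u y I f(1)] by blast
      obtain s where s: "s \<in> low_polys S ?K w (Suc n)" "h g = h u [^]\<^bsub>S\<^esub> n \<otimes>\<^bsub>S\<^esub> s"
        using Suc cg(2) by blast
      have "s \<in> carrier S" using s(1) S.low_polys_closed[OF K w(1)] by blast
      from key[OF cg(1,2) this s(2)] s(1) cg(1)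
      show "z \<in> (\<lambda>s. h u [^]\<^bsub>S\<^esub> Suc n \<otimes>\<^bsub>S\<^esub> s) ` low_polys S ?K w (Suc (Suc n))"
        unfolding f(2) cg(3) S.low_polys_Suc[OF K w(1), of "Suc n"] by blast
    next
      fix z assume "z \<in> (\<lambda>s. h u [^]\<^bsub>S\<^esub> Suc n \<otimes>\<^bsub>S\<^esub> s) ` low_polys S ?K w (Suc (Suc n))"
      then obtain s c where s: "s \<in> low_polys S ?K w (Suc n)" "c \<in> carrier R"
        "z = h u [^]\<^bsub>S\<^esub> Suc n \<otimes>\<^bsub>S\<^esub> (s \<oplus>\<^bsub>S\<^esub> h c \<otimes>\<^bsub>S\<^esub> w [^]\<^bsub>S\<^esub> Suc n)"
        unfolding S.low_polys_Suc[OF K w(1), of "Suc n"] by blast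
      obtain g where g: "g \<in> ideal_pow R I n" "h g = h u [^]\<^bsub>S\<^esub> n \<otimes>\<^bsub>S\<^esub> s"
        using Suc s(1) by (metis (no_types, lifting) imageE image_eqI)
      have "s \<in> carrier S" using s(1) S.low_polys_closed[OF K w(1)] by blast
      from key[OF s(2) g(1) this g(2)] R.ideal_pow_decomp_mem[OF I' uI(2,1) s(2) g(1)]
      show "z \<in> h ` ideal_pow R I (Suc n)" unfolding s(3) by (metis image_eqI)
    qed
  qed
qed

text \<open>Multiplication by a power of the unit \<open>h u\<close> homogenises the equation for
  \<open>w\<close>, and this can be undone. The terms below the leading one all acquire a factor
  \<open>u\<close>, leaving a form of degree only \<open>n\<close>.\<close>

lemma (in ring_hom_cring) monic_root_iff:
  assumes u: "u \<in> carrier R" and y: "y \<in> carrier R" and I: "I = Idl\<^bsub>R\<^esub> {u, y}"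
    and w: "w \<in> carrier S" "h y = w \<otimes>\<^bsub>S\<^esub> h u" and hu: "h u \<in> Units S"
  shows "monic_root S (h ` carrier R) (Suc n) w \<longleftrightarrow>
    (\<exists>g \<in> ideal_pow R I n. h (y [^] Suc n \<oplus> u \<otimes> g) = \<zero>\<^bsub>S\<^esub>)"
proof -
  let ?K = "h ` carrier R"
  have K: "?K \<subseteq> carrier S" by auto
  have I': "ideal I R" unfolding I by (rule R.genideal_ideal) (use u y in auto)
  have hc: "h u \<in> carrier S" using u by simp
  have key: "h (y [^] Suc n \<oplus> u \<otimes> g) = \<zero>\<^bsub>S\<^esub> \<longleftrightarrow> w [^]\<^bsub>S\<^esub> Suc n \<oplus>\<^bsub>S\<^esub> s = \<zero>\<^bsub>S\<^esub>"
    if "g \<in> ideal_pow R I n" "s \<in> carrier S" "h g = h u [^]\<^bsub>S\<^esub> n \<otimes>\<^bsub>S\<^esub> s" for g s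
  proof -
    have g: "g \<in> carrier R" using that(1) R.ideal_ideal_pow[OF I'] ideal.Icarr by metis
    have "h (y [^] Suc n \<oplus> u \<otimes> g) = (w \<otimes>\<^bsub>S\<^esub> h u) [^]\<^bsub>S\<^esub> Suc n \<oplus>\<^bsub>S\<^esub> h u \<otimes>\<^bsub>S\<^esub> (h u [^]\<^bsub>S\<^esub> n \<otimes>\<^bsub>S\<^esub> s)"
      using g y u by (simp add: hom_nat_pow w(2) that(3) del: R.nat_pow_Suc S.nat_pow_Suc)
    also have "(w \<otimes>\<^bsub>S\<^esub> h u) [^]\<^bsub>S\<^esub> Suc n = w [^]\<^bsub>S\<^esub> Suc n \<otimes>\<^bsub>S\<^esub> h u [^]\<^bsub>S\<^esub> Suc n"
      using w(1) hc by (rule S.nat_pow_distrib)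
    also have "w [^]\<^bsub>S\<^esub> Suc n \<otimes>\<^bsub>S\<^esub> h u [^]\<^bsub>S\<^esub> Suc n \<oplus>\<^bsub>S\<^esub> h u \<otimes>\<^bsub>S\<^esub> (h u [^]\<^bsub>S\<^esub> n \<otimes>\<^bsub>S\<^esub> s)
      = h u [^]\<^bsub>S\<^esub> Suc n \<otimes>\<^bsub>S\<^esub> (w [^]\<^bsub>S\<^esub> Suc n \<oplus>\<^bsub>S\<^esub> s)"
      using that(2) w(1) hc by (simp add: S.r_distr S.m_ac S.a_ac)
    finally have e: "h (y [^] Suc n \<oplus> u \<otimes> g) = h u [^]\<^bsub>S\<^esub> Suc n \<otimes>\<^bsub>S\<^esub> (w [^]\<^bsub>S\<^esub> Suc n \<oplus>\<^bsub>S\<^esub> s)" .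
    have U: "h u [^]\<^bsub>S\<^esub> Suc n \<in> Units S" using hu by (rule S.Units_pow_closed)
    have v: "w [^]\<^bsub>S\<^esub> Suc n \<oplus>\<^bsub>S\<^esub> s \<in> carrier S" using w(1) that(2) by simp
    show ?thesis unfolding e using S.Units_l_cancel[OF U v S.zero_closed] S.Units_closed[OF U] by (simp del: S.nat_pow_Suc)
  qed
  have im: "h ` ideal_pow R I n = (\<lambda>s. h u [^]\<^bsub>S\<^esub> n \<otimes>\<^bsub>S\<^esub> s) ` low_polys S ?K w (Suc n)"
    by (rule ideal_pow_image) fact+
  have cl: "low_polys S ?K w (Suc n) \<subseteq> carrier S" by (rule S.low_polys_closed[OF K w(1)])
  show ?thesis unfolding monic_root_low_polys
  proof
    assume "\<exists>s\<in>low_polys S ?K w (Suc n). w [^]\<^bsub>S\<^esub> Suc n \<oplus>\<^bsub>S\<^esub> s = \<zero>\<^bsub>S\<^esub>"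
    then obtain s where s: "s \<in> low_polys S ?K w (Suc n)" "w [^]\<^bsub>S\<^esub> Suc n \<oplus>\<^bsub>S\<^esub> s = \<zero>\<^bsub>S\<^esub>" by blast
    then obtain g where "g \<in> ideal_pow R I n" "h g = h u [^]\<^bsub>S\<^esub> n \<otimes>\<^bsub>S\<^esub> s"
      using im by (metis (no_types, lifting) imageE image_eqI)
    then show "\<exists>g \<in> ideal_pow R I n. h (y [^] Suc n \<oplus> u \<otimes> g) = \<zero>\<^bsub>S\<^esub>"
      using key s cl by blast
  next
    assume "\<exists>g \<in> ideal_pow R I n. h (y [^] Suc n \<oplus> u \<otimes> g) = \<zero>\<^bsub>S\<^esub>"
    then obtain g where g: "g \<in> ideal_pow R I n" "h (y [^] Suc n \<oplus> u \<otimes> g) = \<zero>\<^bsub>S\<^esub>" by blast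
    then obtain s where "s \<in> low_polys S ?K w (Suc n)" "h g = h u [^]\<^bsub>S\<^esub> n \<otimes>\<^bsub>S\<^esub> s"
      using im by blast
    then show "\<exists>s\<in>low_polys S ?K w (Suc n). w [^]\<^bsub>S\<^esub> Suc n \<oplus>\<^bsub>S\<^esub> s = \<zero>\<^bsub>S\<^esub>"
      using key g cl by blast
  qed
qed

text \<open>The given relation, of arbitrary degree \<open>Suc n\<close>, serves only to make
  \<open>y/u\<close> integral over the quotient ring. The integral degree then supplies a relation
  of degree at most \<open>d\<close>, which a power of \<open>y\<close> raises to degree exactly
  \<open>d\<close>.\<close>

lemma integral_degree_form:
  fixes R (structure)
  assumes "cring R" and J: "ideal J R" and deg: "integral_degree (R Quot J) = enat d"
    and u: "u \<in> carrier R" and y: "y \<in> carrier R" and I: "I = Idl {u, y}"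
    and reg: "\<And>g. g \<in> carrier R \<Longrightarrow> u \<otimes> g \<in> J \<Longrightarrow> g \<in> J"
    and c: "c \<in> Units R" and g: "g \<in> ideal_pow R I n"
    and f: "c \<otimes> y [^] Suc n \<oplus> u \<otimes> g \<in> J"
  obtains k h where "d = Suc k" "h \<in> ideal_pow R I k" "y [^] Suc k \<oplus> u \<otimes> h \<in> J"
proof -
  interpret cring R by fact
  interpret J: ideal J R by fact
  let ?Q = "R Quot J"
  interpret Q: cring ?Q by (rule J.quotient_is_cring[OF is_cring])
  let ?T = "total_quotient_ring ?Q"
  interpret T: cring ?T by (rule Q.total_quotient_ring_cring)
  \<comment> \<open>The projection followed by the embedding into the total quotient ring; its
    kernel is \<open>J\<close> and its image is \<open>tq_base\<close>.\<close>
  define h where "h = (\<lambda>a. tq_frac ?Q a \<one>\<^bsub>?Q\<^esub>) \<circ> (+>) J"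
  have "h \<in> ring_hom R ?T"
    unfolding h_def using J.rcos_ring_hom Q.tq_embedding_hom by (rule ring_hom_trans)
  then interpret h: ring_hom_cring R ?T h
    by unfold_locales
  have I': "ideal I R" unfolding I by (rule genideal_ideal) (use u y in auto)
  have yI: "y \<in> I" "u \<in> I" using genideal_self[of "{u,y}"] u y by (auto simp: I)
  have hK: "h ` carrier R = tq_base ?Q"
    unfolding h_def tq_base_def J.carrier_Quot image_comp ..
  have h0: "h z = \<zero>\<^bsub>?T\<^esub> \<longleftrightarrow> z \<in> J" if "z \<in> carrier R" for z
    using that Q.tq_embedding_eq_zero_iff[of "J +> z"] J.rcos_eq_zero_iff[of z]
    by (auto simp: h_def J.carrier_Quot)
  have "J +> u \<notin> zero_divisors ?Q"
    unfolding J.rcos_not_zero_divisor_iff[OF u] using reg by blast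
  moreover have "J +> u \<in> carrier ?Q" unfolding J.carrier_Quot using u by blast
  ultimately have hu: "h u \<in> Units ?T"
    using Q.tq_embedding_unit[of "J +> u"] unfolding h_def by simp
  \<comment> \<open>The fraction \<open>y/u\<close>.\<close>
  define w where "w = h y \<otimes>\<^bsub>?T\<^esub> inv\<^bsub>?T\<^esub> (h u)"
  have w: "w \<in> carrier ?T" "h y = w \<otimes>\<^bsub>?T\<^esub> h u"
    using y hu u by (simp_all add: w_def T.m_assoc)
  note root = h.monic_root_iff[OF u y I w hu, unfolded hK]
  interpret P: ideal "ideal_pow R I m" R for m by (rule ideal_ideal_pow[OF I'])
  \<comment> \<open>Dividing by the unit \<open>c\<close> makes the relation monic.\<close>
  have "inv c \<otimes> (c \<otimes> y [^] Suc n \<oplus> u \<otimes> g) \<in> J" using f c by (simp add: J.I_l_closed)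
  moreover have "inv c \<otimes> (c \<otimes> Y \<oplus> u \<otimes> g) = Y \<oplus> u \<otimes> (inv c \<otimes> g)" if "Y \<in> carrier R" for Y
  proof -
    have cc: "c \<in> carrier R" "inv c \<in> carrier R" "inv c \<otimes> c = \<one>" using c by auto
    have "inv c \<otimes> (c \<otimes> Y \<oplus> u \<otimes> g) = (inv c \<otimes> c) \<otimes> Y \<oplus> u \<otimes> (inv c \<otimes> g)"
      using cc(1,2) P.Icarr[OF g] u that by (simp add: r_distr m_assoc m_lcomm)
    then show ?thesis using that cc(3) by simp
  qed
  ultimately have "y [^] Suc n \<oplus> u \<otimes> (inv c \<otimes> g) \<in> J" using y by simp
  moreover have "inv c \<otimes> g \<in> ideal_pow R I n" using c g by (simp add: P.I_l_closed)
  ultimately have rt: "monic_root ?T (tq_base ?Q) (Suc n) w"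
    unfolding root using h0 P.Icarr u y by (metis a_closed m_closed nat_pow_closed)
  define e where "e = elem_integral_degree ?T (tq_base ?Q) w"
  have ex: "\<exists>n. n \<ge> 1 \<and> monic_root ?T (tq_base ?Q) n w" using rt by (metis le_add1 plus_1_eq_Suc)
  have e: "e \<ge> 1" "monic_root ?T (tq_base ?Q) e w"
    using LeastI_ex[OF ex] unfolding e_def elem_integral_degree_def by auto
  have "w \<in> integral_closure ?Q" using ex w(1) unfolding integral_closure_def integral_over_def by auto
  then have "enat e \<le> integral_degree ?Q"
    unfolding e_def integral_degree_def ext_integral_degree_def by (rule SUP_upper)
  then have ed: "e \<le> d" using deg by simp
  obtain j where j: "e = Suc j" using e(1) by (cases e) auto
  obtain k where k: "d = Suc k" "j \<le> k" using ed j by (cases d) auto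
  obtain q where q: "q \<in> ideal_pow R I j" "h (y [^] Suc j \<oplus> u \<otimes> q) = \<zero>\<^bsub>?T\<^esub>"
    using e(2) unfolding j root by blast
  have qc: "q \<in> carrier R" using P.Icarr q(1) by blast
  have "y [^] Suc j \<oplus> u \<otimes> q \<in> J" using h0[of "y [^] Suc j \<oplus> u \<otimes> q"] q(2) qc u y by simp
  \<comment> \<open>The exponent \<open>k - j\<close> is \<open>d\<close> minus the degree
    \<open>e\<close> of the minimal equation.\<close>
  then have "y [^] (k - j) \<otimes> (y [^] Suc j \<oplus> u \<otimes> q) \<in> J" using y by (simp add: J.I_l_closed)
  moreover have "y [^] (k - j) \<otimes> (y [^] Suc j \<oplus> u \<otimes> q) = y [^] Suc k \<oplus> u \<otimes> (y [^] (k - j) \<otimes> q)"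
  proof -
    have "y [^] (k - j) \<otimes> y [^] Suc j = y [^] Suc k"
      using nat_pow_mult[OF y, of "k - j" "Suc j"] k(2) by simp
    then show ?thesis using y u qc by (simp add: r_distr m_lcomm del: nat_pow_Suc)
  qed
  moreover have "y [^] (k - j) \<otimes> q \<in> ideal_pow R I k"
    using pow_mult_in_ideal_pow[OF I' yI(1) q(1), of "k - j"] k(2) by simp
  ultimately show ?thesis using that[OF k(1)] by simp
qed


section \<open>The intersection of the powers with the ideal\<close>

theorem theorem8p6:
  fixes A :: "('a, 'b) ring_scheme" (structure)
    and \<mm> \<aa> I :: "'a set"
    and d :: nat
  assumes "noetherian_ring A" and "local_ring A \<mm>"
    and "infinite (carrier (A Quot \<mm>))"
    and "ideal \<aa> A"
    and "integral_degree (A Quot \<aa>) = enat d"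
    and "two_generated A I"
    and "regular_ideal (A Quot \<aa>) (quot_ext A \<aa> I)"
  shows "\<forall>n\<ge>d. ideal_pow A I n \<inter> \<aa> =
    (ideal_pow A I (n - d) \<cdot> (ideal_pow A I d \<inter> \<aa>)) <+> ((\<mm> \<cdot> ideal_pow A I n) \<inter> \<aa>)"
proof -
  have cr: "cring A" and max: "maximalideal \<mm> A" using assms(2) unfolding local_ring_def by auto
  interpret cring A by (rule cr)
  interpret a: ideal \<aa> A by fact
  interpret m: maximalideal \<mm> A by (rule max)
  have prime: "primeideal \<mm> A" by (rule maximalideal_prime[OF max])
  obtain x y where xy: "x \<in> carrier A" "y \<in> carrier A" "I = Idl {x, y}"
    using assms(6) unfolding two_generated_def by blast
  have I: "ideal I A" unfolding xy(3) by (rule genideal_ideal) (use xy in auto)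
  have IxyI: "x \<in> I" "y \<in> I" using genideal_self[of "{x,y}"] xy by auto
  interpret P: ideal "ideal_pow A I n" A for n by (rule ideal_ideal_pow[OF I])
  let ?N = "ideal_pow A I d \<inter> \<aa>"
  have N: "ideal ?N A" by (rule i_intersect[OF P.is_ideal a.is_ideal])
  let ?F = "\<lambda>n. ideal_pow A I (n - d) \<cdot> ?N"
  let ?G = "\<lambda>n. (\<mm> \<cdot> ideal_pow A I n) \<inter> \<aa>"
  have F: "ideal (?F n) A" and mP: "ideal (\<mm> \<cdot> ideal_pow A I n) A" for n
    by (auto intro: ideal_prod_is_ideal P.is_ideal N m.is_ideal)
  have G: "ideal (?G n) A" for n by (rule i_intersect[OF mP a.is_ideal])
  obtain L where L: "infinite L" "L \<subseteq> carrier A"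
      "\<And>k l. k \<in> L \<Longrightarrow> l \<in> L \<Longrightarrow> k \<noteq> l \<Longrightarrow> k \<ominus> l \<notin> \<mm>"
    using m.infinite_representatives[OF assms(3)] by blast
  have Ldiff: "k \<ominus> l \<in> Units A" if "k \<in> L" "l \<in> L" "k \<noteq> l" for k l
    using that L by (intro not_in_local_maximal_imp_unit[OF assms(2)]) auto
  \<comment> \<open>Since the projection is surjective, the image of \<open>I\<close> is already an
    ideal, so a regular element of the extended ideal comes from an element of
    \<open>I\<close>.\<close>
  obtain i where i: "i \<in> I" "\<And>g. g \<in> carrier A \<Longrightarrow> i \<otimes> g \<in> \<aa> \<Longrightarrow> g \<in> \<aa>"
  proof -
    have "ideal ((+>) \<aa> ` I) (A Quot \<aa>)" by (rule ring_ideal_imp_quot_ideal[OF a.is_ideal I])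
    then have "quot_ext A \<aa> I \<subseteq> (+>) \<aa> ` I"
      unfolding quot_ext_def by (intro ring.genideal_minimal a.quotient_is_ring) auto
    then obtain i where "i \<in> I" "\<aa> +> i \<notin> zero_divisors (A Quot \<aa>)"
      using assms(7) unfolding regular_ideal_def by blast
    then show ?thesis using that a.rcos_not_zero_divisor_iff[of i] ideal.Icarr[OF I] by blast
  qed
  have sub: "f \<in> ?F n <+>\<^bsub>A\<^esub> ?G n" if "n \<ge> d" "f \<in> ideal_pow A I n \<inter> \<aa>" for n f
    using that
  proof (induction n arbitrary: f rule: nat_induct_at_least)
    case base
    \<comment> \<open>The zeroth power of \<open>I\<close> is the whole ring.\<close>
    then have "\<one> \<otimes> f \<in> ?F d" by (intro ideal_prod.prod) auto
    then have "f \<in> ?F d" using base P.Icarr by auto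
    moreover have "f = f \<oplus> \<zero>" using base P.Icarr by auto
    moreover have "\<zero> \<in> ?G d" by (rule additive_subgroup.zero_closed[OF ideal.axioms(1)[OF G]])
    ultimately show ?case unfolding set_add_def' by blast
  next
    case (Suc n)
    let ?good = "\<lambda>l. monic_form A \<mm> I (x \<oplus> l \<otimes> y) y (Suc n) f"
    show ?case
    proof (cases "infinite {l \<in> L. \<not> ?good l}")
      case True
      have "f \<in> \<mm> \<cdot> ideal_pow A I (Suc n)"
        by (rule not_monic_form_imp_mem_mult[OF prime xy _ True]) (use Suc.prems L in auto)
      then have "f \<in> ?G (Suc n)" using Suc.prems by simp
      moreover have "f = \<zero> \<oplus> f" using Suc.prems P.Icarr[of f "Suc n"] by auto
      moreover have "\<zero> \<in> ?F (Suc n)" by (rule additive_subgroup.zero_closed[OF ideal.axioms(1)[OF F]])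
      ultimately show ?thesis unfolding set_add_def' by blast
    next
      case False
      \<comment> \<open>Only finitely many \<open>l\<close> are bad now. The infinitely many good
        ones suffice to find one that is also regular modulo \<open>\<aa>\<close>.\<close>
      let ?L = "{l \<in> L. ?good l}"
      have "L = {l \<in> L. \<not> ?good l} \<union> ?L" by blast
      then have "infinite ?L" using L(1) False by (metis (no_types, lifting) finite_Un)
      then have "\<exists>l\<in>?L. \<forall>g\<in>carrier A. (x \<oplus> l \<otimes> y) \<otimes> g \<in> \<aa> \<longrightarrow> g \<in> \<aa>"
        by (intro exists_regular_combination[OF cr assms(1) a.is_ideal xy(1,2) i[unfolded xy(3)]])
           (use L(2) Ldiff in auto)
      then obtain l where l: "l \<in> ?L" "\<And>g. g \<in> carrier A \<Longrightarrow> (x \<oplus> l \<otimes> y) \<otimes> g \<in> \<aa> \<Longrightarrow> g \<in> \<aa>"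
        by blast
      define u where "u = x \<oplus> l \<otimes> y"
      have lc: "l \<in> carrier A" using l L by auto
      have u: "u \<in> carrier A" using xy lc by (simp add: u_def)
      have Iu: "I = Idl {u, y}" using Idl_pair_shift[OF xy(1,2) lc] xy(3) by (simp add: u_def)
      have uI: "u \<in> I" using genideal_self[of "{u,y}"] u xy(2) by (auto simp: Iu)
      obtain c g where c: "c \<in> carrier A" "c \<notin> \<mm>" and g: "g \<in> ideal_pow A I n"
        and f: "f = c \<otimes> y [^] Suc n \<oplus> u \<otimes> g"
        using l(1) unfolding monic_form_def u_def by auto
      have cU: "c \<in> Units A" by (rule not_in_local_maximal_imp_unit[OF assms(2) c])
      obtain k h where k: "d = Suc k" and h: "h \<in> ideal_pow A I k" "y [^] Suc k \<oplus> u \<otimes> h \<in> \<aa>"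
        using integral_degree_form[OF cr a.is_ideal assms(5) u xy(2) Iu _ cU g] l(2) f Suc.prems
        unfolding u_def by blast
      have yn: "y [^] (n - k) \<otimes> y [^] Suc k = y [^] Suc n"
        using nat_pow_mult[OF xy(2), of "n - k" "Suc k"] Suc.hyps k by simp
      define H where "H = y [^] Suc k \<oplus> u \<otimes> h"
      \<comment> \<open>Chosen so that \<open>b \<otimes> H\<close> has the same leading term as
        \<open>f\<close>; what remains is a multiple of \<open>u\<close>.\<close>
      define b where "b = c \<otimes> y [^] (n - k)"
      have hc: "h \<in> carrier A" and gc: "g \<in> carrier A" using h(1) g P.Icarr by blast+
      have bc: "b \<in> carrier A" using c xy by (simp add: b_def)
      have Hc: "H \<in> carrier A" using hc u xy by (simp add: H_def)
      have "H \<in> ideal_pow A I d"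
        using ideal_pow_decomp_mem[OF I IxyI(2) uI one_closed h(1)] xy(2) unfolding k H_def
        by (simp del: nat_pow_Suc)
      then have HN: "H \<in> ?N" using h(2) by (simp add: H_def)
      have bP: "b \<in> ideal_pow A I (n - k)"
        unfolding b_def by (rule P.I_l_closed[OF nat_pow_in_ideal_pow[OF I IxyI(2)] c(1)])
      define g' where "g' = g \<ominus> b \<otimes> h"
      have "y [^] (n - k) \<otimes> h \<in> ideal_pow A I n"
        using pow_mult_in_ideal_pow[OF I IxyI(2) h(1), of "n - k"] Suc.hyps k by simp
      then have bh: "b \<otimes> h \<in> ideal_pow A I n"
        using P.I_l_closed[OF _ c(1)] xy hc c unfolding b_def by (simp add: m_assoc)
      then have g'P: "g' \<in> ideal_pow A I n" unfolding g'_def minus_eq using g by blast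
      have e: "f = b \<otimes> H \<oplus> u \<otimes> g'"
      proof -
        have "b \<otimes> H = c \<otimes> y [^] Suc n \<oplus> u \<otimes> (b \<otimes> h)"
        proof -
          have "b \<otimes> H = c \<otimes> (y [^] (n - k) \<otimes> y [^] Suc k) \<oplus> u \<otimes> (b \<otimes> h)"
            unfolding H_def using bc u hc xy(2) c(1)
            by (simp add: r_distr m_lcomm[of _ u] b_def m_assoc del: nat_pow_Suc)
          then show ?thesis unfolding yn .
        qed
        moreover have "Y \<oplus> u \<otimes> g = (Y \<oplus> u \<otimes> (b \<otimes> h)) \<oplus> u \<otimes> g'" if "Y \<in> carrier A" for Y
          unfolding g'_def using that u gc bc hc by algebra
        ultimately show ?thesis unfolding f using c(1) xy(2) by (simp del: nat_pow_Suc)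
      qed
      have g'c: "g' \<in> carrier A" using g'P P.Icarr by blast
      have "f \<ominus> b \<otimes> H \<in> \<aa>" using Suc.prems HN bc unfolding minus_eq by (intro a.a_closed a.a_inv_closed a.I_l_closed) auto
      moreover have "f \<ominus> b \<otimes> H = u \<otimes> g'" unfolding e using bc Hc u g'c by algebra
      ultimately have "g' \<in> \<aa>" using l(2)[OF g'c] by (simp add: u_def)
      then obtain p q where pq: "p \<in> ?F n" "q \<in> ?G n" "g' = p \<oplus> q"
        using Suc.IH[of g'] g'P unfolding set_add_def' by blast
      have pc: "p \<in> carrier A" and qc: "q \<in> carrier A"
        using pq ideal.Icarr[OF F] ideal.Icarr[OF G] by blast+
      \<comment> \<open>Two readings of one exponent: the first suits the multiplication of
        \<open>?F n\<close> by \<open>u\<close>, the second the degree \<open>n - k\<close> of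
        \<open>b\<close>.\<close>
      have sd: "Suc n - d = Suc (n - d)" "Suc n - d = n - k" using Suc.hyps k by auto
      have "u \<otimes> p \<in> ?F (Suc n)"
        using mult_mem_ideal_prod_left[OF P.is_ideal I N uI pq(1)] unfolding sd(1) by simp
      moreover have "b \<otimes> H \<in> ?F (Suc n)"
        unfolding sd(2) by (rule ideal_prod.prod[OF bP HN])
      ultimately have "b \<otimes> H \<oplus> u \<otimes> p \<in> ?F (Suc n)" by (rule ideal_prod.sum[rotated])
      moreover have "u \<otimes> q \<in> ?G (Suc n)"
        using mult_mem_ideal_prod_right[OF P.is_ideal I m.is_ideal uI, of q] pq(2) a.I_l_closed[OF _ u] by simp
      moreover have "f = (b \<otimes> H \<oplus> u \<otimes> p) \<oplus> u \<otimes> q"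
        unfolding e pq(3) using bc Hc u pc qc by algebra
      ultimately show ?thesis unfolding set_add_def' by blast
    qed
  qed
  show ?thesis
  proof (intro allI impI equalityI subsetI)
    fix n f assume "n \<ge> d" "f \<in> ideal_pow A I n \<inter> \<aa>"
    then show "f \<in> ?F n <+>\<^bsub>A\<^esub> ?G n" by (rule sub)
  next
    fix n f assume nd: "n \<ge> d" and "f \<in> ?F n <+>\<^bsub>A\<^esub> ?G n"
    then obtain p q where pq: "p \<in> ?F n" "q \<in> ?G n" "f = p \<oplus> q" unfolding set_add_def' by blast
    \<comment> \<open>For the reverse inclusion, the factor from \<open>?N\<close> puts
      \<open>p\<close> into \<open>\<aa>\<close>, and the exponents \<open>n - d\<close> and
      \<open>d\<close> add up to \<open>n\<close>.\<close>
    have "p \<in> \<aa>" using pq(1) ideal_prod_inter[OF P.is_ideal N] by blast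
    moreover have "p \<in> ideal_pow A I (n - d) \<cdot> ideal_pow A I d"
      using pq(1) by (induction rule: ideal_prod.induct) (auto intro: ideal_prod.intros)
    then have "p \<in> ideal_pow A I n" using ideal_pow_add[OF I, of "n - d" d] nd by simp
    moreover have "q \<in> ideal_pow A I n" "q \<in> \<aa>"
      using pq(2) ideal_prod_inter[OF m.is_ideal P.is_ideal] by blast+
    ultimately show "f \<in> ideal_pow A I n \<inter> \<aa>" unfolding pq(3) by auto
  qed
qed

end
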